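(* Let $(g_h^n)_{n\ge0}\subset V^h$ satisfy the $Q^k$ finite element scheme $$(\mathcal M g_h^{n+1},\phi_h)+\Delta t\,(D\mathcal M\nabla g_h^{n+1},\nabla\phi_h)+\Delta t\,(\vec u\,g_h^{n+1},\nabla\phi_h)=(\mathcal M g_h^n,\phi_h)\qquad\forall\phi_h\in V^h,$$ set $\rho_h^n=\mathcal M g_h^n$, and assume $\int_\Omega\rho_h^0=\int_\Omega\mathcal M$. Then for any $n\ge0$ $$\frac1{\Delta t}\int_\Omega\frac{(\rho_h^{n+1}-\mathcal M)^2}{\mathcal M}-\frac1{\Delta t}\int_\Omega\frac{(\rho_h^{n}-\mathcal M)^2}{\mathcal M}\le-\frac{2D}{c}\int_\Omega\frac{(\rho_h^{n+1}-\mathcal M)^2}{\mathcal M},$$ where $c$ is the weighted Poincaré constant of $(\Omega,\mathcal M)$. Consequently, $$\int_\Omega\frac{(\rho_h^n-\mathcal M)^2}{\mathcal M}\le(1-\beta)^n\int_\Omega\frac{(\rho_h^0-\mathcal M)^2}{\mathcal M}\le e^{-\beta n}\int_\Omega\frac{(\rho_h^0-\mathcal M)^2}{\mathcal M},\qquad\beta=\frac{2D\Delta t}{c+2D\Delta t}>0.$$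
   Context: $\Omega\subset\mathbb R^d$ ($d=1$ or $2$) is a bounded rectangular domain with outward unit normal $\vec n$; $D>0$ is a constant; $\Delta t>0$; $\mathcal M\in C^1(\bar\Omega)$ is a given function with $\mathcal M\ge\epsilon_0>0$ and $\int_\Omega\mathcal M=1$ (the invariant measure); $\vec u$ is a given time-independent continuously differentiable vector field with $\nabla\cdot\vec u=0$ in $\Omega$ and $\vec u\cdot\vec n=0$ on $\partial\Omega$. $\mathcal E_h$ is a uniform rectangular partition of $\Omega$; for an integer $k\ge1$, $V^h=\{v_h\in C(\Omega): v_h|_E\in\mathbb Q^k(E)\ \forall E\in\mathcal E_h\}\subset H^1(\Omega)$, where $\mathbb Q^k(E)$ is the space of polynomials on $E$ of degree at most $k$ in each variable. $(\cdot,\cdot)$ is the $L^2(\Omega)$ inner product. Weighted Poincaré constant: $c>0$ is a constant such that $\int_\Omega|v|^2\mathcal M\le c\int_\Omega\mathcal M|\nabla v|^2$ for all $v\in H^1(\Omega)$ with $\int_\Omega v\,\mathcal M=0$. *)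

theory Defs
  imports "HOL-Analysis.Analysis"
begin

section \<open>Classical differential operators and smoothness classes\<close>

definition grad :: "('a::euclidean_space \<Rightarrow> real) \<Rightarrow> 'a \<Rightarrow> 'a" where
  "grad f x = (\<Sum>i\<in>Basis. frechet_derivative f (at x) i *\<^sub>R i)"

definition divergence :: "('a::euclidean_space \<Rightarrow> 'a) \<Rightarrow> 'a \<Rightarrow> real" where
  "divergence F x = (\<Sum>i\<in>Basis. frechet_derivative F (at x) i \<bullet> i)"

definition C1_open :: "'a::euclidean_space set \<Rightarrow> ('a \<Rightarrow> 'b::real_normed_vector) \<Rightarrow> bool" where
  "C1_open \<Omega> f \<longleftrightarrow>
     (\<forall>x\<in>\<Omega>. f differentiable (at x)) \<and>
     (\<forall>i\<in>Basis. continuous_on \<Omega> (\<lambda>x. frechet_derivative f (at x) i))"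

text \<open>\<open>C\<^sup>1\<close> up to the boundary: \<open>f\<close> is continuous on the closure and its first-order partial
  derivatives, defined on the open set, extend continuously to the closure.\<close>

definition C1_closure :: "'a::euclidean_space set \<Rightarrow> ('a \<Rightarrow> 'b::real_normed_vector) \<Rightarrow> bool" where
  "C1_closure \<Omega> f \<longleftrightarrow>
     C1_open \<Omega> f \<and> continuous_on (closure \<Omega>) f \<and>
     (\<forall>i\<in>Basis. \<exists>F. continuous_on (closure \<Omega>) F \<and>
        (\<forall>x\<in>\<Omega>. F x = frechet_derivative f (at x) i))"

primrec Ck :: "nat \<Rightarrow> ('a::euclidean_space \<Rightarrow> real) \<Rightarrow> bool" where
  "Ck 0 f \<longleftrightarrow> continuous_on UNIV f"
| "Ck (Suc m) f \<longleftrightarrow>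
     (\<forall>x. f differentiable (at x)) \<and> (\<forall>i\<in>Basis. Ck m (\<lambda>x. frechet_derivative f (at x) i))"

definition test_functions :: "'a::euclidean_space set \<Rightarrow> ('a \<Rightarrow> real) set" where
  "test_functions \<Omega> =
     {\<phi>. (\<forall>m. Ck m \<phi>) \<and> compact (closure {x. \<phi> x \<noteq> 0}) \<and> closure {x. \<phi> x \<noteq> 0} \<subseteq> \<Omega>}"


section \<open>\<open>L\<^sup>2\<close>, \<open>H\<^sup>1\<close> and the weighted Poincare constant\<close>

definition L2_inner ::
    "'a::euclidean_space set \<Rightarrow> ('a \<Rightarrow> 'b::euclidean_space) \<Rightarrow> ('a \<Rightarrow> 'b) \<Rightarrow> real" where
  "L2_inner \<Omega> f g = (\<integral>x. f x \<bullet> g x \<partial>lebesgue_on \<Omega>)"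

definition L2 :: "'a::euclidean_space set \<Rightarrow> ('a \<Rightarrow> 'b::euclidean_space) set" where
  "L2 \<Omega> = {f \<in> borel_measurable (lebesgue_on \<Omega>). integrable (lebesgue_on \<Omega>) (\<lambda>x. (norm (f x))\<^sup>2)}"

definition weak_gradient :: "'a::euclidean_space set \<Rightarrow> ('a \<Rightarrow> real) \<Rightarrow> ('a \<Rightarrow> 'a) \<Rightarrow> bool" where
  "weak_gradient \<Omega> v G \<longleftrightarrow>
     (\<forall>\<phi>\<in>test_functions \<Omega>. \<forall>i\<in>Basis.
        (\<integral>x. v x * frechet_derivative \<phi> (at x) i \<partial>lebesgue_on \<Omega>)
        = - (\<integral>x. (G x \<bullet> i) * \<phi> x \<partial>lebesgue_on \<Omega>))"

text \<open>\<open>v\<close> belongs to \<open>H\<^sup>1(\<Omega>)\<close> iff \<open>H1_with_gradient \<Omega> v G\<close> holds for some \<open>G\<close>; that \<open>G\<close> is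
  \<open>\<nabla>v\<close>, which is determined only almost everywhere in \<open>\<Omega>\<close>.  This is why the definition of the
  Poincare constant below quantifies over pairs \<open>(v, G)\<close>.\<close>

definition H1_with_gradient :: "'a::euclidean_space set \<Rightarrow> ('a \<Rightarrow> real) \<Rightarrow> ('a \<Rightarrow> 'a) \<Rightarrow> bool" where
  "H1_with_gradient \<Omega> v G \<longleftrightarrow> v \<in> L2 \<Omega> \<and> G \<in> L2 \<Omega> \<and> weak_gradient \<Omega> v G"

definition weighted_Poincare_constant ::
    "'a::euclidean_space set \<Rightarrow> ('a \<Rightarrow> real) \<Rightarrow> real \<Rightarrow> bool" where
  "weighted_Poincare_constant \<Omega> M c \<longleftrightarrow>
     0 < c \<and>
     (\<forall>v G. H1_with_gradient \<Omega> v G \<longrightarrow> (\<integral>x. v x * M x \<partial>lebesgue_on \<Omega>) = 0 \<longrightarrow>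
        (\<integral>x. \<bar>v x\<bar>\<^sup>2 * M x \<partial>lebesgue_on \<Omega>)
        \<le> c * (\<integral>x. M x * (norm (G x))\<^sup>2 \<partial>lebesgue_on \<Omega>))"


section \<open>Rectangles, uniform rectangular partitions and the \<open>Q\<^sup>k\<close> space\<close>

text \<open>\<open>n\<close> is the outward unit normal of the rectangle \<open>box a b\<close> at a point \<open>x\<close> in the relative
  interior of one of its faces.  At the remaining boundary points (corners in two dimensions) there
  is no normal.\<close>

definition outward_unit_normal :: "'a::euclidean_space \<Rightarrow> 'a \<Rightarrow> 'a \<Rightarrow> 'a \<Rightarrow> bool" where
  "outward_unit_normal a b x n \<longleftrightarrow>
     (\<exists>i\<in>Basis. (x \<bullet> i = b \<bullet> i \<and> n = i \<or> x \<bullet> i = a \<bullet> i \<and> n = - i) \<and>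
        (\<forall>j\<in>Basis - {i}. a \<bullet> j < x \<bullet> j \<and> x \<bullet> j < b \<bullet> j))"

definition grid_point ::
    "'a::euclidean_space \<Rightarrow> 'a \<Rightarrow> ('a \<Rightarrow> nat) \<Rightarrow> ('a \<Rightarrow> nat) \<Rightarrow> 'a" where
  "grid_point a b N j =
     (\<Sum>i\<in>Basis. (a \<bullet> i + real (j i) * ((b \<bullet> i - a \<bullet> i) / real (N i))) *\<^sub>R i)"

text \<open>The elements are closed.  Coordinate direction \<open>i\<close> is cut into \<open>N i\<close> intervals of equal
  length; the mesh sizes in different directions may differ.\<close>

definition uniform_rect_partition :: "'a::euclidean_space \<Rightarrow> 'a \<Rightarrow> 'a set set \<Rightarrow> bool" where
  "uniform_rect_partition a b \<E> \<longleftrightarrow>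
     (\<exists>N. (\<forall>i\<in>Basis. 0 < N i) \<and>
        \<E> = {cbox (grid_point a b N j) (grid_point a b N (\<lambda>i. j i + 1)) | j.
               \<forall>i\<in>Basis. j i < N i})"

definition Qk :: "nat \<Rightarrow> ('a::euclidean_space \<Rightarrow> real) set" where
  "Qk k = {p. \<exists>coef. \<forall>x. p x = (\<Sum>\<alpha>\<in>Basis \<rightarrow>\<^sub>E {..k}. coef \<alpha> * (\<Prod>i\<in>Basis. (x \<bullet> i) ^ \<alpha> i))}"

definition fe_space :: "'a::euclidean_space set \<Rightarrow> 'a set set \<Rightarrow> nat \<Rightarrow> ('a \<Rightarrow> real) set" where
  "fe_space \<Omega> \<E> k =
     {v. continuous_on \<Omega> v \<and> (\<forall>E\<in>\<E>. \<exists>p\<in>Qk k. \<forall>x\<in>E. v x = p x)}"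

text \<open>For \<open>v\<close> in the finite element space, \<open>grad v\<close> is the elementwise gradient of the polynomials
  \<open>v|\<^sub>E\<close>.  It is meaningful off the element faces, a null set on which its values do not
  affect the Lebesgue integrals below, and it is a version of the weak gradient of \<open>v\<close>.\<close>

definition fe_scheme ::
    "'a::euclidean_space set \<Rightarrow> ('a \<Rightarrow> real) set \<Rightarrow> real \<Rightarrow> real \<Rightarrow> ('a \<Rightarrow> real) \<Rightarrow> ('a \<Rightarrow> 'a)
      \<Rightarrow> (nat \<Rightarrow> 'a \<Rightarrow> real) \<Rightarrow> bool" where
  "fe_scheme \<Omega> V D \<Delta>t M u g \<longleftrightarrow>
     (\<forall>n. g n \<in> V) \<and>
     (\<forall>n. \<forall>\<phi>\<in>V.
        L2_inner \<Omega> (\<lambda>x. M x * g (Suc n) x) \<phi>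
        + \<Delta>t * L2_inner \<Omega> (\<lambda>x. (D * M x) *\<^sub>R grad (g (Suc n)) x) (grad \<phi>)
        + \<Delta>t * L2_inner \<Omega> (\<lambda>x. g (Suc n) x *\<^sub>R u x) (grad \<phi>)
        = L2_inner \<Omega> (\<lambda>x. M x * g n x) \<phi>)"

end

theory Submission
  imports Defs
begin

text \<open>
  Testing the scheme with \<open>1\<close> gives conservation of mass, so \<open>w = g\<^sup>n\<^sup>+\<^sup>1 - 1\<close> has weighted mean zero.
  Testing with \<open>w\<close> gives the energy inequality once the convective term
  \<open>\<integral> g \<nabla>w \<bullet> u = \<integral> u \<bullet> \<nabla>(g\<^sup>2/2)\<close> is seen to vanish; the weighted Poincare inequality then bounds
  the dissipation from below.

  Both the vanishing of the convective term and the fact that the elementwise gradient is a weak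
  gradient are instances of \<open>\<integral> F \<bullet> \<nabla>\<psi> = - \<integral> \<psi> div F\<close> for a continuous, piecewise \<open>C\<^sup>1\<close> function \<open>\<psi>\<close>
  and a field \<open>F\<close> with \<open>F \<bullet> n = 0\<close>. As \<open>F\<close> is differentiable only in the open box, its individual
  partial derivatives need not be integrable up to the boundary, so the identity is obtained on
  shrinking inner boxes \<open>P\<close>. There \<open>\<integral>\<^sub>P \<partial>\<^sub>i f\<close> is the limit of the integrals of difference quotients
  \<open>(f(x + h e\<^sub>i) - f(x)) / h\<close>; these cancel except on two slabs of thickness \<open>h\<close> along the faces of \<open>P\<close>
  normal to \<open>e\<^sub>i\<close>, where \<open>f = \<psi> F\<^sub>i\<close> is uniformly small.
\<close>

section \<open>Functions of class C1\<close>

lemma frechet_derivative_mult_real: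
  fixes f g :: "'a::euclidean_space \<Rightarrow> real"
  assumes "f differentiable (at x)" "g differentiable (at x)"
  shows "frechet_derivative (\<lambda>x. f x * g x) (at x) h =
    f x * frechet_derivative g (at x) h + frechet_derivative f (at x) h * g x"
proof -
  have "((\<lambda>x. f x * g x) has_derivative
      (\<lambda>h. f x * frechet_derivative g (at x) h + frechet_derivative f (at x) h * g x)) (at x)"
    using has_derivative_mult[of f _ x UNIV g] assms by (simp add: frechet_derivative_works)
  from frechet_derivative_at[OF this] show ?thesis
    by metis
qed

lemma frechet_derivative_add_real:
  fixes f g :: "'a::euclidean_space \<Rightarrow> real"
  assumes "f differentiable (at x)" "g differentiable (at x)"
  shows "frechet_derivative (\<lambda>x. f x + g x) (at x) h =
    frechet_derivative f (at x) h + frechet_derivative g (at x) h"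
proof -
  have "((\<lambda>x. f x + g x) has_derivative
      (\<lambda>h. frechet_derivative f (at x) h + frechet_derivative g (at x) h)) (at x)"
    using has_derivative_add[of f _ "at x" g] assms by (simp add: frechet_derivative_works)
  from frechet_derivative_at[OF this] show ?thesis
    by metis
qed

text \<open>\<open>frechet_derivative\<close> is a choice among the maps satisfying
  \<open>has_derivative\<close>. Functions agreeing near \<open>x\<close> satisfy this relation for
  the same maps, so the choices coincide, even where no derivative exists.\<close>

lemma frechet_derivative_eq_on_open:
  assumes "open S" "x \<in> S" "\<And>y. y \<in> S \<Longrightarrow> f y = g y"
  shows "frechet_derivative f (at x) = frechet_derivative g (at x)"
proof -
  have "(f has_derivative F) (at x) \<longleftrightarrow> (g has_derivative F) (at x)" for F
    using has_derivative_transform_within_open[OF _ assms(1,2), of f F UNIV g]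
      has_derivative_transform_within_open[OF _ assms(1,2), of g F UNIV f] assms(3) by auto
  then show ?thesis
    unfolding frechet_derivative_def by simp
qed

lemma C1_open_const: "C1_open S (\<lambda>x. c)"
  by (simp add: C1_open_def)

lemma C1_open_inner_left: "C1_open S (\<lambda>x. x \<bullet> i)"
proof -
  have "frechet_derivative (\<lambda>x. x \<bullet> i) (at x) = (\<lambda>x. x \<bullet> i)" for x
    by (rule frechet_derivative_at[symmetric]) (auto intro!: derivative_eq_intros)
  moreover have "(\<lambda>x. x \<bullet> i) differentiable (at x)" for x
    by (auto simp: differentiable_def intro!: derivative_eq_intros exI)
  ultimately show ?thesis
    by (simp add: C1_open_def)
qed

lemma C1_open_imp_continuous_on: "C1_open S f \<Longrightarrow> continuous_on S f"
  by (meson C1_open_def continuous_at_imp_continuous_on differentiable_imp_continuous_within)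

lemma C1_open_add:
  fixes f g :: "'a::euclidean_space \<Rightarrow> real"
  assumes "C1_open S f" "C1_open S g"
  shows "C1_open S (\<lambda>x. f x + g x)"
proof -
  have "continuous_on S (\<lambda>x. frechet_derivative f (at x) i + frechet_derivative g (at x) i)"
    if "i \<in> Basis" for i
    using assms that by (intro continuous_intros) (auto simp: C1_open_def)
  then show ?thesis
    using assms unfolding C1_open_def
    by (auto simp: frechet_derivative_add_real intro: differentiable_add cong: continuous_on_cong)
qed

lemma C1_open_mult:
  fixes f g :: "'a::euclidean_space \<Rightarrow> real"
  assumes "C1_open S f" "C1_open S g"
  shows "C1_open S (\<lambda>x. f x * g x)"
proof -
  have "continuous_on S (\<lambda>x. f x * frechet_derivative g (at x) i + frechet_derivative f (at x) i * g x)"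
    if "i \<in> Basis" for i
    using assms[THEN C1_open_imp_continuous_on] assms that
    by (intro continuous_intros) (auto simp: C1_open_def)
  then show ?thesis
    using assms unfolding C1_open_def
    by (auto simp: frechet_derivative_mult_real intro: differentiable_mult cong: continuous_on_cong)
qed

lemma C1_open_sum:
  fixes f :: "'b \<Rightarrow> 'a::euclidean_space \<Rightarrow> real"
  assumes "\<And>j. j \<in> I \<Longrightarrow> C1_open S (f j)"
  shows "C1_open S (\<lambda>x. \<Sum>j\<in>I. f j x)"
  using assms by (induction I rule: infinite_finite_induct) (auto intro: C1_open_add C1_open_const)

lemma C1_open_prod:
  fixes f :: "'b \<Rightarrow> 'a::euclidean_space \<Rightarrow> real"
  assumes "\<And>j. j \<in> I \<Longrightarrow> C1_open S (f j)"
  shows "C1_open S (\<lambda>x. \<Prod>j\<in>I. f j x)"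
  using assms by (induction I rule: infinite_finite_induct) (auto intro: C1_open_mult C1_open_const)

lemma C1_open_power:
  fixes f :: "'a::euclidean_space \<Rightarrow> real"
  assumes "C1_open S f"
  shows "C1_open S (\<lambda>x. f x ^ n)"
  using assms by (induction n) (auto intro: C1_open_mult C1_open_const)

lemma C1_open_subset: "C1_open S f \<Longrightarrow> T \<subseteq> S \<Longrightarrow> C1_open T f"
  unfolding C1_open_def by (meson continuous_on_subset subsetD)

text \<open>The neighbourhood \<open>W\<close> carries the derivative of \<open>p\<close> over to
  \<open>f\<close> at every point of \<open>W\<close>, not only at \<open>x\<close>; this is what
  continuity of the partial derivatives at \<open>x\<close> requires. The representative
  \<open>p\<close> may change with \<open>x\<close>, as it does from cell to cell.\<close>

lemma C1_open_local:
  fixes f :: "'a::euclidean_space \<Rightarrow> real"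
  assumes "\<And>x. x \<in> S \<Longrightarrow> \<exists>W p. open W \<and> x \<in> W \<and> C1_open UNIV p \<and> (\<forall>y\<in>W. f y = p y)"
  shows "C1_open S f"
  unfolding C1_open_def
proof (intro conjI ballI)
  fix x assume "x \<in> S"
  then obtain W p where W: "open W" "x \<in> W" "C1_open UNIV p" "\<forall>y\<in>W. f y = p y"
    using assms[OF \<open>x \<in> S\<close>] by metis
  have "p differentiable (at x)"
    using W(3) by (simp add: C1_open_def)
  then have "(p has_derivative frechet_derivative p (at x)) (at x)"
    unfolding frechet_derivative_works .
  then have "(f has_derivative frechet_derivative p (at x)) (at x)"
    by (rule has_derivative_transform_within_open[OF _ W(1,2)]) (simp add: W(4))
  then show "f differentiable (at x)"
    unfolding differentiable_def by blast
next
  fix i :: 'a assume i: "i \<in> Basis"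
  show "continuous_on S (\<lambda>x. frechet_derivative f (at x) i)"
  proof (intro continuous_at_imp_continuous_on ballI)
    fix x assume "x \<in> S"
    then obtain W p where W: "open W" "x \<in> W" "C1_open UNIV p" "\<forall>y\<in>W. f y = p y"
      using assms[OF \<open>x \<in> S\<close>] by metis
    have "continuous_on W (\<lambda>x. frechet_derivative p (at x) i)"
      using W(3) i unfolding C1_open_def by (meson continuous_on_subset subset_UNIV)
    then have "continuous_on W (\<lambda>x. frechet_derivative f (at x) i)"
      using frechet_derivative_eq_on_open[OF W(1) _ W(4)[rule_format]] by (simp cong: continuous_on_cong)
    then show "isCont (\<lambda>x. frechet_derivative f (at x) i) x"
      using W(1,2) by (simp add: continuous_on_eq_continuous_at)
  qed
qed

lemma C1_open_Qk: "p \<in> Qk k \<Longrightarrow> C1_open S p"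
proof -
  assume "p \<in> Qk k"
  then obtain coef where
    "p = (\<lambda>x. \<Sum>\<alpha>\<in>Basis \<rightarrow>\<^sub>E {..k}. coef \<alpha> * (\<Prod>i\<in>Basis. (x \<bullet> i) ^ \<alpha> i))"
    unfolding Qk_def by blast
  then show ?thesis
    by (simp only:) (intro C1_open_sum C1_open_mult C1_open_const C1_open_prod C1_open_power
        C1_open_inner_left)
qed

section \<open>Continuous piecewise C1 functions\<close>

text \<open>The points of \<open>S\<close> on none of the coordinate hyperplanes \<open>x\<^sub>i = t\<close> with \<open>t \<in> T i\<close>; for the
  finite element functions these hyperplanes carry the faces of the elements.\<close>

definition off_grid :: "('a::euclidean_space \<Rightarrow> real set) \<Rightarrow> 'a set \<Rightarrow> 'a set" where
  "off_grid T S = {x \<in> S. \<forall>i\<in>Basis. x \<bullet> i \<notin> T i}"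

lemma off_grid_union: "off_grid (\<lambda>i. T i \<union> T' i) S \<subseteq> off_grid T S"
    "off_grid (\<lambda>i. T i \<union> T' i) S \<subseteq> off_grid T' S"
  by (auto simp: off_grid_def)

lemma open_off_grid:
  assumes "open S" "\<And>i. i \<in> Basis \<Longrightarrow> finite (T i)"
  shows "open (off_grid T S)"
proof -
  have "off_grid T S = S \<inter> (\<Inter>i\<in>Basis. (\<lambda>x. x \<bullet> i) -` (- T i))"
    by (auto simp: off_grid_def)
  moreover have "open ((\<lambda>x. x \<bullet> i) -` (- T i))" if "i \<in> Basis" for i :: 'a
    using assms(2)[OF that]
    by (intro open_vimage continuous_intros) (auto simp: finite_imp_closed)
  ultimately show ?thesis
    using assms(1) by (auto intro!: open_Int open_INT)
qed

lemma negligible_not_off_grid: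
  assumes "\<And>i. i \<in> Basis \<Longrightarrow> finite (T i)"
  shows "negligible (S - off_grid T S)"
proof -
  have "negligible (\<Union>i\<in>Basis. \<Union>t\<in>T i. {x. x \<bullet> i = t})"
    using assms by (auto intro!: negligible_Union negligible_standard_hyperplane)
  then show ?thesis
    by (rule negligible_subset) (auto simp: off_grid_def)
qed

text \<open>Lets classical derivatives be used under integrals: the grid hyperplanes, where they may
  fail to exist, form a null set.\<close>

lemma AE_off_grid:
  assumes "S \<in> sets lebesgue" "\<And>i. i \<in> Basis \<Longrightarrow> finite (T i)"
  shows "AE x in lebesgue_on S. x \<in> off_grid T S"
proof -
  have "S - off_grid T S \<in> null_sets lebesgue"
    using negligible_not_off_grid[OF assms(2), where S = S] by (simp add: negligible_iff_null_sets)
  then have "AE x in lebesgue. x \<in> S \<longrightarrow> x \<in> off_grid T S"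
    by (rule AE_I') auto
  then show ?thesis
    using assms(1) by (simp add: AE_restrict_space_iff)
qed

text \<open>Boundedness is built in because \<open>S\<close> will be an open box, where continuity
  alone bounds neither \<open>f\<close> nor its partial derivatives. The grid \<open>T\<close> is
  existential so that two functions can be treated on a common refinement.\<close>

definition piecewise_C1 :: "'a::euclidean_space set \<Rightarrow> ('a \<Rightarrow> real) \<Rightarrow> bool" where
  "piecewise_C1 S f \<longleftrightarrow>
     continuous_on S f \<and> bounded (f ` S) \<and>
     (\<exists>T B. (\<forall>i\<in>Basis. finite (T i)) \<and> C1_open (off_grid T S) f \<and>
        (\<forall>x\<in>off_grid T S. \<forall>i\<in>Basis. \<bar>frechet_derivative f (at x) i\<bar> \<le> B))"

lemma piecewise_C1E:
  assumes "piecewise_C1 S f"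
  obtains T B where "\<forall>i\<in>Basis. finite (T i)" "C1_open (off_grid T S) f"
    "\<forall>x\<in>off_grid T S. \<forall>i\<in>Basis. \<bar>frechet_derivative f (at x) i\<bar> \<le> B"
    "\<forall>x\<in>S. \<bar>f x\<bar> \<le> B" "B \<ge> 0"
proof -
  from assms obtain T B where 1: "\<forall>i\<in>Basis. finite (T i)" "C1_open (off_grid T S) f"
    "\<forall>x\<in>off_grid T S. \<forall>i\<in>Basis. \<bar>frechet_derivative f (at x) i\<bar> \<le> B"
    unfolding piecewise_C1_def by blast
  from assms obtain B' where B': "B' > 0" "\<forall>x\<in>S. \<bar>f x\<bar> \<le> B'"
    unfolding piecewise_C1_def bounded_pos by auto
  show ?thesis
    by (rule that[of T "max B B'"]) (use 1 B' in \<open>auto simp: le_max_iff_disj\<close>)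
qed

text \<open>The union of the two hyperplane families works, since enlarging a grid only shrinks
  \<open>off_grid\<close>.\<close>

lemma piecewise_C1_common_grid:
  assumes "piecewise_C1 S f" "piecewise_C1 S g"
  obtains T B where "\<forall>i\<in>Basis. finite (T i)"
    "C1_open (off_grid T S) f" "C1_open (off_grid T S) g"
    "\<forall>x\<in>off_grid T S. \<forall>i\<in>Basis. \<bar>frechet_derivative f (at x) i\<bar> \<le> B"
    "\<forall>x\<in>off_grid T S. \<forall>i\<in>Basis. \<bar>frechet_derivative g (at x) i\<bar> \<le> B"
    "\<forall>x\<in>S. \<bar>f x\<bar> \<le> B" "\<forall>x\<in>S. \<bar>g x\<bar> \<le> B" "B \<ge> 0"
proof -
  obtain T B where f: "\<forall>i\<in>Basis. finite (T i)" "C1_open (off_grid T S) f"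
    "\<forall>x\<in>off_grid T S. \<forall>i\<in>Basis. \<bar>frechet_derivative f (at x) i\<bar> \<le> B"
    "\<forall>x\<in>S. \<bar>f x\<bar> \<le> B" "B \<ge> 0"
    using piecewise_C1E[OF assms(1)] by blast
  obtain T' B' where g: "\<forall>i\<in>Basis. finite (T' i)" "C1_open (off_grid T' S) g"
    "\<forall>x\<in>off_grid T' S. \<forall>i\<in>Basis. \<bar>frechet_derivative g (at x) i\<bar> \<le> B'"
    "\<forall>x\<in>S. \<bar>g x\<bar> \<le> B'" "B' \<ge> 0"
    using piecewise_C1E[OF assms(2)] by blast
  let ?U = "off_grid (\<lambda>i. T i \<union> T' i) S"
  show ?thesis
  proof (rule that[of "\<lambda>i. T i \<union> T' i" "max B B'"]; (intro ballI)?)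
    fix x and i :: 'a assume *: "x \<in> ?U" "i \<in> Basis"
    show "\<bar>frechet_derivative f (at x) i\<bar> \<le> max B B'"
      using f(3)[rule_format, OF subsetD[OF off_grid_union(1) *(1)] *(2)] by simp
    show "\<bar>frechet_derivative g (at x) i\<bar> \<le> max B B'"
      using g(3)[rule_format, OF subsetD[OF off_grid_union(2) *(1)] *(2)] by simp
  next
    fix x assume "x \<in> S"
    then show "\<bar>f x\<bar> \<le> max B B'" "\<bar>g x\<bar> \<le> max B B'"
      using f(4) g(4) by auto
  next
    show "max B B' \<ge> 0"
      using f(5) by simp
  qed (simp_all add: f(1) g(1) C1_open_subset[OF f(2) off_grid_union(1)]
        C1_open_subset[OF g(2) off_grid_union(2)])
qed

lemma piecewise_C1I:
  assumes "continuous_on S f" "\<And>x. x \<in> S \<Longrightarrow> \<bar>f x\<bar> \<le> C" "\<And>i. i \<in> Basis \<Longrightarrow> finite (T i)"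
    "C1_open (off_grid T S) f"
    "\<And>x i. x \<in> off_grid T S \<Longrightarrow> i \<in> Basis \<Longrightarrow> \<bar>frechet_derivative f (at x) i\<bar> \<le> B"
  shows "piecewise_C1 S f"
proof -
  have "bounded (f ` S)"
    using assms(2) unfolding bounded_iff by auto
  moreover have "(\<forall>i\<in>Basis. finite (T i)) \<and> C1_open (off_grid T S) f \<and>
        (\<forall>x\<in>off_grid T S. \<forall>i\<in>Basis. \<bar>frechet_derivative f (at x) i\<bar> \<le> B)"
    using assms(3-5) by simp
  ultimately show ?thesis
    using assms(1) unfolding piecewise_C1_def by blast
qed

lemma piecewise_C1_mult:
  assumes "piecewise_C1 S f" "piecewise_C1 S g"
  shows "piecewise_C1 S (\<lambda>x. f x * g x)"
proof -
  obtain T B where T: "\<forall>i\<in>Basis. finite (T i)"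
    "C1_open (off_grid T S) f" "C1_open (off_grid T S) g"
    "\<forall>x\<in>off_grid T S. \<forall>i\<in>Basis. \<bar>frechet_derivative f (at x) i\<bar> \<le> B"
    "\<forall>x\<in>off_grid T S. \<forall>i\<in>Basis. \<bar>frechet_derivative g (at x) i\<bar> \<le> B"
    "\<forall>x\<in>S. \<bar>f x\<bar> \<le> B" "\<forall>x\<in>S. \<bar>g x\<bar> \<le> B" "B \<ge> 0"
    using piecewise_C1_common_grid[OF assms] by blast
  show ?thesis
  \<comment> \<open>The two terms of the product rule contribute \<open>B * B\<close> each.\<close>
  proof (rule piecewise_C1I[where T = T and B = "B * B + B * B" and C = "B * B"])
    fix x i assume *: "x \<in> off_grid T S" "i \<in> (Basis::'a set)"
    then have d: "f differentiable (at x)" "g differentiable (at x)" and "x \<in> S"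
      using T(2,3) by (auto simp: C1_open_def off_grid_def)
    have "\<bar>f x * frechet_derivative g (at x) i\<bar> \<le> B * B"
      unfolding abs_mult by (intro mult_mono) (use T(5)[rule_format, OF *] T(6)[rule_format, OF \<open>x \<in> S\<close>] T(8) in auto)
    moreover have "\<bar>frechet_derivative f (at x) i * g x\<bar> \<le> B * B"
      unfolding abs_mult by (intro mult_mono) (use T(4)[rule_format, OF *] T(7)[rule_format, OF \<open>x \<in> S\<close>] T(8) in auto)
    ultimately show "\<bar>frechet_derivative (\<lambda>x. f x * g x) (at x) i\<bar> \<le> B * B + B * B"
      by (simp add: frechet_derivative_mult_real[OF d])
  next
    fix x assume "x \<in> S"
    then show "\<bar>f x * g x\<bar> \<le> B * B"
      unfolding abs_mult by (intro mult_mono) (use T(6-8) in auto)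
  qed (use T C1_open_mult assms in \<open>auto simp: piecewise_C1_def intro!: continuous_intros\<close>)
qed

lemma piecewise_C1_const: "piecewise_C1 S (\<lambda>x. c)"
  by (rule piecewise_C1I[where T = "\<lambda>_. {}" and B = 0 and C = "\<bar>c\<bar>"]) (auto intro: C1_open_const)

lemma C1_open_bounded_on_compact:
  fixes f :: "'a::euclidean_space \<Rightarrow> real"
  assumes "C1_open U f" "compact K" "K \<subseteq> U"
  obtains B where "\<forall>x\<in>K. \<bar>f x\<bar> \<le> B"
    "\<forall>x\<in>K. \<forall>i\<in>Basis. \<bar>frechet_derivative f (at x) i\<bar> \<le> B"
proof -
  have *: "\<exists>B. \<forall>x\<in>K. \<bar>h x\<bar> \<le> B" if "continuous_on U h" for h :: "'a \<Rightarrow> real"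
    using compact_imp_bounded[OF compact_continuous_image[OF continuous_on_subset[OF that \<open>K \<subseteq> U\<close>] \<open>compact K\<close>]]
    by (auto simp: bounded_iff)
  obtain C where C: "\<forall>x\<in>K. \<bar>f x\<bar> \<le> C"
    using *[OF C1_open_imp_continuous_on[OF assms(1)]] by blast
  have "\<forall>i\<in>Basis. \<exists>B. \<forall>x\<in>K. \<bar>frechet_derivative f (at x) i\<bar> \<le> B"
    using assms(1) * unfolding C1_open_def by blast
  then obtain B where B: "\<forall>i\<in>Basis. \<forall>x\<in>K. \<bar>frechet_derivative f (at x) i\<bar> \<le> B i"
    by metis
  show ?thesis
  \<comment> \<open>A sum of absolute values dominates each of its terms, which yields one constant
    for the function and for all directions.\<close>
  proof (rule that[of "\<bar>C\<bar> + (\<Sum>i\<in>Basis. \<bar>B i\<bar>)"]; intro ballI)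
    fix x i assume *: "x \<in> K" "i \<in> (Basis::'a set)"
    then have "\<bar>frechet_derivative f (at x) i\<bar> \<le> B i"
      using B by blast
    also have "\<dots> \<le> (\<Sum>i\<in>Basis. \<bar>B i\<bar>)"
      using member_le_sum[of i Basis "\<lambda>i. \<bar>B i\<bar>"] *(2) by auto
    finally show "\<bar>frechet_derivative f (at x) i\<bar> \<le> \<bar>C\<bar> + (\<Sum>i\<in>Basis. \<bar>B i\<bar>)"
      by simp
  next
    fix x assume "x \<in> K"
    then have "\<bar>f x\<bar> \<le> \<bar>C\<bar>"
      using C by force
    moreover have "0 \<le> (\<Sum>i\<in>Basis. \<bar>B i\<bar>)"
      by (simp add: sum_nonneg)
    ultimately show "\<bar>f x\<bar> \<le> \<bar>C\<bar> + (\<Sum>i\<in>Basis. \<bar>B i\<bar>)"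
      by linarith
  qed
qed

text \<open>The intermediate compact \<open>K\<close> supplies the bounds: a \<open>C1_open\<close>
  function may have unbounded partial derivatives near the boundary of \<open>U\<close>. The grid is
  empty.\<close>

lemma piecewise_C1_on_compact_subset:
  fixes f :: "'a::euclidean_space \<Rightarrow> real"
  assumes "C1_open U f" "compact K" "S \<subseteq> K" "K \<subseteq> U"
  shows "piecewise_C1 S f"
proof -
  obtain B where B: "\<forall>x\<in>K. \<bar>f x\<bar> \<le> B"
    "\<forall>x\<in>K. \<forall>i\<in>Basis. \<bar>frechet_derivative f (at x) i\<bar> \<le> B"
    by (rule C1_open_bounded_on_compact[OF assms(1,2,4)]) (rule that)
  have "C1_open S f"
    using assms C1_open_subset by blast
  moreover have "off_grid (\<lambda>_. {}) S = S"
    by (simp add: off_grid_def)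
  ultimately show ?thesis
    using B \<open>S \<subseteq> K\<close>
    by (intro piecewise_C1I[where T = "\<lambda>_. {}" and B = B and C = B])
      (auto intro: C1_open_imp_continuous_on)
qed

lemma piecewise_C1_subset:
  assumes "piecewise_C1 S f" "S' \<subseteq> S"
  shows "piecewise_C1 S' f"
proof -
  obtain T B where T: "\<forall>i\<in>Basis. finite (T i)" "C1_open (off_grid T S) f"
    "\<forall>x\<in>off_grid T S. \<forall>i\<in>Basis. \<bar>frechet_derivative f (at x) i\<bar> \<le> B"
    "\<forall>x\<in>S. \<bar>f x\<bar> \<le> B" "B \<ge> 0"
    using piecewise_C1E[OF assms(1)] by blast
  have "off_grid T S' \<subseteq> off_grid T S"
    using assms(2) by (auto simp: off_grid_def)
  then show ?thesis
    using assms T C1_open_subset[OF T(2)]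
    by (intro piecewise_C1I[where T = T and B = B and C = B])
      (auto simp: piecewise_C1_def intro: continuous_on_subset)
qed

section \<open>Measurability, almost-everywhere bounds and integrability\<close>

lemma integrable_lebesgue_on_bounded:
  fixes h :: "'a::euclidean_space \<Rightarrow> 'b::euclidean_space"
  assumes "S \<in> lmeasurable" "h \<in> borel_measurable (lebesgue_on S)"
    "AE x in lebesgue_on S. norm (h x) \<le> B"
  shows "integrable (lebesgue_on S) h"
  using finite_measure.integrable_const_bound[OF finite_measure_lebesgue_on[OF assms(1)] assms(3,2)] .

lemma piecewise_C1_measurable:
  assumes "piecewise_C1 S f" "S \<in> sets lebesgue"
  shows "f \<in> borel_measurable (lebesgue_on S)"
  using assms by (auto simp: piecewise_C1_def intro: continuous_imp_measurable_on_sets_lebesgue)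

text \<open>On the open set \<open>off_grid T S\<close> the partial derivative is continuous, so its
  extension by zero is measurable. On \<open>S\<close> the actual function differs from it only in a
  null set, and Lebesgue measure is complete.\<close>

lemma piecewise_C1_derivative_measurable:
  fixes f :: "'a::euclidean_space \<Rightarrow> real"
  assumes "piecewise_C1 S f" "open S" "i \<in> Basis"
  shows "(\<lambda>x. frechet_derivative f (at x) i) \<in> borel_measurable (lebesgue_on S)"
proof -
  obtain T where T: "\<forall>i\<in>Basis. finite (T i)" "C1_open (off_grid T S) f"
    by (rule piecewise_C1E[OF assms(1)]) (rule that)
  let ?U = "off_grid T S" and ?p = "\<lambda>x. frechet_derivative f (at x) i"
  have "open ?U"
    using T(1) \<open>open S\<close> by (simp add: open_off_grid)
  have "continuous_on ?U ?p"
    using T(2) \<open>i \<in> Basis\<close> by (simp add: C1_open_def)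
  then have "?p \<in> borel_measurable (lebesgue_on ?U)"
    by (rule continuous_imp_measurable_on_sets_lebesgue) (simp add: \<open>open ?U\<close>)
  then have *: "(\<lambda>x. if x \<in> ?U then ?p x else 0) \<in> borel_measurable lebesgue"
    by (rule borel_measurable_if_I) (simp add: \<open>open ?U\<close>)
  have "AE x in lebesgue. x \<in> S \<longrightarrow> x \<in> ?U"
    using AE_off_grid[of S T] T(1) \<open>open S\<close> by (simp add: AE_restrict_space_iff)
  then have "AE x in lebesgue. (if x \<in> ?U then ?p x else 0) = (if x \<in> S then ?p x else 0)"
    by eventually_elim (auto simp: off_grid_def)
  from borel_measurable_AE[OF * this] show ?thesis
    by (rule borel_measurable_if_D)
qed

lemma piecewise_C1_AE_bound:
  assumes "piecewise_C1 S f" "open S"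
  obtains B where "B \<ge> 0" "\<forall>x\<in>S. \<bar>f x\<bar> \<le> B"
    "AE x in lebesgue_on S. f differentiable (at x) \<and>
      (\<forall>i\<in>Basis. \<bar>frechet_derivative f (at x) i\<bar> \<le> B)"
proof -
  obtain T B where T: "\<forall>i\<in>Basis. finite (T i)" "C1_open (off_grid T S) f"
    "\<forall>x\<in>off_grid T S. \<forall>i\<in>Basis. \<bar>frechet_derivative f (at x) i\<bar> \<le> B"
    "\<forall>x\<in>S. \<bar>f x\<bar> \<le> B" "B \<ge> 0"
    by (rule piecewise_C1E[OF assms(1)]) (rule that)
  have "AE x in lebesgue_on S. x \<in> off_grid T S"
    using T(1) \<open>open S\<close> by (intro AE_off_grid) auto
  then have "AE x in lebesgue_on S. f differentiable (at x) \<and>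
      (\<forall>i\<in>Basis. \<bar>frechet_derivative f (at x) i\<bar> \<le> B)"
    by eventually_elim (use T(2,3) in \<open>auto simp: C1_open_def\<close>)
  with T that show ?thesis by blast
qed

section \<open>The integral of a partial derivative over an inner box\<close>

text \<open>A line in direction \<open>i\<close> from a point off the grid keeps its other
  coordinates, so it meets only hyperplanes orthogonal to \<open>i\<close>, at finitely many
  parameters. The fundamental theorem of calculus with finitely many exceptions then applies. The
  bound later dominates the difference quotients.\<close>

lemma piecewise_C1_line_bound:
  fixes f :: "'a::euclidean_space \<Rightarrow> real"
  assumes "continuous_on S f" "finite (T i)" "C1_open (off_grid T S) f" "i \<in> Basis" "0 \<le> h"
    and B: "\<forall>x\<in>off_grid T S. \<bar>frechet_derivative f (at x) i\<bar> \<le> B" "B \<ge> 0"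
    and x: "x \<in> off_grid T S" "\<And>t. 0 \<le> t \<Longrightarrow> t \<le> h \<Longrightarrow> x + t *\<^sub>R i \<in> S"
  shows "\<bar>f (x + h *\<^sub>R i) - f x\<bar> \<le> B * h"
proof -
  let ?\<gamma> = "\<lambda>t. f (x + t *\<^sub>R i)" and ?d = "\<lambda>t. frechet_derivative f (at (x + t *\<^sub>R i)) i"
  \<comment> \<open>The parameters \<open>t\<close> at which \<open>x + t *\<^sub>R i\<close>
    crosses a hyperplane of \<open>T i\<close>.\<close>
  define K where "K = (\<lambda>s. s - x \<bullet> i) ` T i"
  have "finite K"
    using assms(2) by (simp add: K_def)
  have good: "x + t *\<^sub>R i \<in> off_grid T S" if "t \<in> {0..h} - K" for t
  proof -
    have "(x + t *\<^sub>R i) \<bullet> j \<notin> T j" if "j \<in> Basis" for j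
    proof (cases "j = i")
      case True
      have "x \<bullet> i + t \<notin> T i"
        using \<open>t \<in> {0..h} - K\<close> imageI[of "x \<bullet> i + t" "T i" "\<lambda>s. s - x \<bullet> i"]
        by (auto simp: K_def)
      then show ?thesis
        using True \<open>i \<in> Basis\<close> by (auto simp: inner_simps)
    next
      case False
      then show ?thesis
        using x(1) that \<open>i \<in> Basis\<close> by (auto simp: off_grid_def inner_simps inner_Basis)
    qed
    then show ?thesis
      using x(2) that by (auto simp: off_grid_def)
  qed
  have "(?d has_integral (?\<gamma> h - ?\<gamma> 0)) {0..h}"
  proof (rule fundamental_theorem_of_calculus_interior_strong[OF \<open>finite K\<close> \<open>0 \<le> h\<close>])
    fix t assume "t \<in> {0<..<h} - K"
    then have "f differentiable (at (x + t *\<^sub>R i))"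
      using good[of t] assms(3) by (auto simp: C1_open_def)
    then have d: "(f has_derivative frechet_derivative f (at (x + t *\<^sub>R i))) (at (x + t *\<^sub>R i))"
      by (simp add: frechet_derivative_works)
    have "(?\<gamma> has_derivative (\<lambda>s. frechet_derivative f (at (x + t *\<^sub>R i)) (s *\<^sub>R i))) (at t)"
      by (rule has_derivative_compose[where f = "\<lambda>t. x + t *\<^sub>R i", OF _ d]) (auto intro!: derivative_eq_intros)
    moreover have "linear (frechet_derivative f (at (x + t *\<^sub>R i)))"
      using d by (simp add: has_derivative_linear)
    ultimately show "(?\<gamma> has_vector_derivative ?d t) (at t)"
      by (simp add: has_vector_derivative_def linear_scale)
  next
    show "continuous_on {0..h} ?\<gamma>"
      by (rule continuous_on_compose2[OF assms(1)]) (use x(2) in \<open>auto intro!: continuous_intros\<close>)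
  qed
  then have "norm (?\<gamma> h - ?\<gamma> 0) \<le> B * measure lborel (cbox 0 h)"
    unfolding box_real(2)[symmetric]
    by (rule has_integral_bound_spike_finite[OF \<open>B \<ge> 0\<close> \<open>finite K\<close>]) (use B good in auto)
  then show ?thesis
    using \<open>0 \<le> h\<close> by simp
qed

text \<open>The shifted integral lives on
  \<open>cbox (p + h *\<^sub>R i) (q + h *\<^sub>R i)\<close>. Cutting the union of both boxes at
  height \<open>q \<bullet> i\<close> and at height \<open>p \<bullet> i + h\<close> shows that the
  common part cancels. Two slabs remain, each of volume \<open>h\<close> times the face area, on
  which \<open>\<bar>f x\<bar> \<le> e\<close>.\<close>

lemma integral_shift_difference_bound:
  fixes f :: "'a::euclidean_space \<Rightarrow> real"
  assumes "\<forall>j\<in>Basis. p \<bullet> j \<le> q \<bullet> j" "i \<in> Basis" "0 \<le> h" "h \<le> q \<bullet> i - p \<bullet> i"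
    and cont: "continuous_on (cbox p (q + h *\<^sub>R i)) f"
    and bound: "\<forall>x\<in>cbox p (q + h *\<^sub>R i). x \<bullet> i \<le> p \<bullet> i + h \<or> q \<bullet> i \<le> x \<bullet> i \<longrightarrow> \<bar>f x\<bar> \<le> e"
    and "0 \<le> e"
  shows "\<bar>integral (cbox p q) (\<lambda>x. f (x + h *\<^sub>R i)) - integral (cbox p q) f\<bar>
    \<le> 2 * e * h * (\<Prod>j\<in>Basis - {i}. q \<bullet> j - p \<bullet> j)"
proof -
  let ?h = "h *\<^sub>R i" and ?A = "\<Prod>j\<in>Basis - {i}. q \<bullet> j - p \<bullet> j"
  \<comment> \<open>\<open>q'\<close> is the upper corner of the slab at the lower face,
    \<open>p'\<close> the lower corner of the slab at the upper face.\<close>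
  define q' where "q' = q + (p \<bullet> i + h - q \<bullet> i) *\<^sub>R i"
  define p' where "p' = p + (q \<bullet> i - p \<bullet> i) *\<^sub>R i"
  have q': "q' \<bullet> j = (if j = i then p \<bullet> i + h else q \<bullet> j)" if "j \<in> Basis" for j
    using that \<open>i \<in> Basis\<close> by (auto simp: q'_def inner_simps inner_Basis)
  have p': "p' \<bullet> j = (if j = i then q \<bullet> i else p \<bullet> j)" if "j \<in> Basis" for j
    using that \<open>i \<in> Basis\<close> by (auto simp: p'_def inner_simps inner_Basis)
  have sh: "(x + h *\<^sub>R i) \<bullet> j = (if j = i then x \<bullet> i + h else x \<bullet> j)" if "j \<in> Basis" for j x
    using that \<open>i \<in> Basis\<close> by (auto simp: inner_simps inner_Basis)
  let ?Q = "cbox p (q + ?h)"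
  have int: "f integrable_on ?Q"
    using cont by (rule integrable_continuous)
  have 1: "?Q \<inter> {x. x \<bullet> i \<le> q \<bullet> i} = cbox p q"
    using assms(2,3) by (auto simp: mem_box sh split: if_splits) (smt (verit, best) sh)+
  have 2: "?Q \<inter> {x. x \<bullet> i \<ge> q \<bullet> i} = cbox p' (q + ?h)"
    using assms(1,2) by (auto simp: mem_box p' split: if_splits) (smt (verit, best) p')+
  have 3: "?Q \<inter> {x. x \<bullet> i \<ge> p \<bullet> i + h} = cbox (p + ?h) (q + ?h)"
    using assms(2,3) by (auto simp: mem_box sh split: if_splits) (smt (verit, best) sh)+
  have 4: "?Q \<inter> {x. x \<bullet> i \<le> p \<bullet> i + h} = cbox p q'"
    using assms(2,3,4) by (auto simp: mem_box sh q' split: if_splits) (smt (verit, best) sh q')+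
  have split1: "integral ?Q f = integral (cbox p q) f + integral (cbox p' (q + ?h)) f"
    using integral_split[OF int \<open>i \<in> Basis\<close>, of "q \<bullet> i"] unfolding 1 2 .
  have split2: "integral ?Q f = integral (cbox p q') f + integral (cbox (p + ?h) (q + ?h)) f"
    using integral_split[OF int \<open>i \<in> Basis\<close>, of "p \<bullet> i + h"] unfolding 3 4 .
  have shift: "integral (cbox p q) (\<lambda>x. f (x + ?h)) = integral (cbox (p + ?h) (q + ?h)) f"
    using integral_shift_cbox_plus[of p q f ?h] by (simp add: o_def add.commute)
  have cont1: "measure lborel (cbox p q') = h * ?A"
  proof -
    have "measure lborel (cbox p q') = (\<Prod>j\<in>Basis. q' \<bullet> j - p \<bullet> j)"
      using assms by (intro content_cbox) (auto simp: q')
    also have "\<dots> = (q' \<bullet> i - p \<bullet> i) * (\<Prod>j\<in>Basis - {i}. q' \<bullet> j - p \<bullet> j)"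
      using \<open>i \<in> Basis\<close> by (simp add: prod.remove)
    also have "\<dots> = h * ?A"
      using \<open>i \<in> Basis\<close> by (auto simp: q' intro!: prod.cong)
    finally show ?thesis .
  qed
  have cont2: "measure lborel (cbox p' (q + ?h)) = h * ?A"
  proof -
    have "measure lborel (cbox p' (q + ?h)) = (\<Prod>j\<in>Basis. (q + ?h) \<bullet> j - p' \<bullet> j)"
      using assms by (intro content_cbox) (auto simp: p' sh)
    also have "\<dots> = ((q + ?h) \<bullet> i - p' \<bullet> i) * (\<Prod>j\<in>Basis - {i}. (q + ?h) \<bullet> j - p' \<bullet> j)"
      using \<open>i \<in> Basis\<close> by (simp add: prod.remove)
    also have "\<dots> = h * ?A"
      using \<open>i \<in> Basis\<close> by (auto simp: p' sh intro!: prod.cong)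
    finally show ?thesis .
  qed
  have "\<bar>integral (cbox p q') f\<bar> \<le> e * measure lborel (cbox p q')"
    unfolding real_norm_def[symmetric]
  proof (rule has_integral_bound[OF \<open>0 \<le> e\<close>])
    show "(f has_integral integral (cbox p q') f) (cbox p q')"
      using int 4 by (metis Int_lower1 integrable_integral integrable_on_subcbox)
  qed (use bound 4 in auto)
  moreover have "\<bar>integral (cbox p' (q + ?h)) f\<bar> \<le> e * measure lborel (cbox p' (q + ?h))"
    unfolding real_norm_def[symmetric]
  proof (rule has_integral_bound[OF \<open>0 \<le> e\<close>])
    show "(f has_integral integral (cbox p' (q + ?h)) f) (cbox p' (q + ?h))"
      using int 2 by (metis Int_lower1 integrable_integral integrable_on_subcbox)
  qed (use bound 2 in auto)
  ultimately show ?thesis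
    using split1 split2 unfolding shift cont1 cont2 by (simp add: algebra_simps abs_le_iff)
qed

text \<open>The slab estimate divided by \<open>h\<close> bounds the integrals of the difference
  quotients uniformly in \<open>h\<close>. Dominated convergence, with the bound along lines as
  majorant, passes to the derivative.\<close>

lemma piecewise_C1_integral_derivative_bound:
  fixes f :: "'a::euclidean_space \<Rightarrow> real"
  assumes pw: "piecewise_C1 (box c d) f" and sub: "cbox p q \<subseteq> box c d"
    and pq: "\<forall>j\<in>Basis. p \<bullet> j < q \<bullet> j" and i: "i \<in> Basis" and \<delta>: "\<delta> > 0"
    and e: "\<forall>x\<in>box c d. \<bar>x \<bullet> i - p \<bullet> i\<bar> \<le> \<delta> \<or> \<bar>x \<bullet> i - q \<bullet> i\<bar> \<le> \<delta> \<longrightarrow> \<bar>f x\<bar> \<le> e"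
  shows "\<bar>\<integral>x. frechet_derivative f (at x) i \<partial>lebesgue_on (cbox p q)\<bar>
    \<le> 2 * e * (\<Prod>j\<in>Basis - {i}. q \<bullet> j - p \<bullet> j)"
proof -
  let ?P = "cbox p q" and ?S = "box c d" and ?A = "\<Prod>j\<in>Basis - {i}. q \<bullet> j - p \<bullet> j"
  obtain T B where T: "\<forall>i\<in>Basis. finite (T i)" "C1_open (off_grid T ?S) f"
    "\<forall>x\<in>off_grid T ?S. \<forall>i\<in>Basis. \<bar>frechet_derivative f (at x) i\<bar> \<le> B"
    "\<forall>x\<in>?S. \<bar>f x\<bar> \<le> B" "B \<ge> 0"
    by (rule piecewise_C1E[OF pw]) (rule that)
  have cont: "continuous_on ?S f"
    using pw by (simp add: piecewise_C1_def)
  have "p \<in> ?P" "q \<in> ?P"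
    using pq by (auto simp: mem_box less_imp_le)
  then have "p \<in> ?S" "q \<in> ?S"
    using sub by auto
  have "e \<ge> 0"
    using e \<open>p \<in> ?S\<close> \<delta> by force
  \<comment> \<open>At most \<delta>, so that the slabs stay where \<open>f\<close> is small; at
    most the edge length, so that the slab estimate applies; at most half the gap to the face of
    \<open>box c d\<close>, so that shifted points stay inside.\<close>
  define h0 where "h0 = min \<delta> (min (q \<bullet> i - p \<bullet> i) ((d \<bullet> i - q \<bullet> i) / 2))"
  have "h0 > 0"
    using \<delta> pq i \<open>q \<in> ?S\<close> by (auto simp: h0_def mem_box)
  define h where "h n = h0 / real (Suc n)" for n
  have h: "0 < h n" "h n \<le> h0" for n
    using \<open>h0 > 0\<close> by (auto simp: h_def field_simps)
  have h_lim: "h \<longlonglongrightarrow> 0"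
    unfolding h_def using LIMSEQ_Suc[OF lim_const_over_n[of h0]] by simp
  have Qsub: "cbox p (q + t *\<^sub>R i) \<subseteq> ?S" if "0 \<le> t" "t \<le> h0" for t
  proof
    fix x assume "x \<in> cbox p (q + t *\<^sub>R i)"
    moreover have "(q + t *\<^sub>R i) \<bullet> j < d \<bullet> j" if "j \<in> Basis" for j
      using \<open>q \<in> ?S\<close> that i \<open>t \<le> h0\<close> by (auto simp: h0_def mem_box inner_simps inner_Basis)
    ultimately show "x \<in> ?S"
      using \<open>p \<in> ?S\<close> by (auto simp: mem_box) (meson le_less_trans less_le_trans)+
  qed
  have shiftP: "x + t *\<^sub>R i \<in> cbox p (q + t *\<^sub>R i)" if "x \<in> ?P" "0 \<le> t" for x t
    using that i by (auto simp: mem_box inner_simps inner_Basis add_increasing2)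
  have shiftS: "x + t *\<^sub>R i \<in> ?S" if "x \<in> ?P" "0 \<le> t" "t \<le> h0" for x t
    using shiftP[OF that(1,2)] Qsub[OF that(2,3)] by blast
  define s where "s n x = (f (x + h n *\<^sub>R i) - f x) / h n" for n x
  have contP: "continuous_on ?P f"
    using cont sub by (rule continuous_on_subset)
  have contPh: "continuous_on ?P (\<lambda>x. f (x + h n *\<^sub>R i))" for n
    by (rule continuous_on_compose2[OF cont])
      (use shiftS[of _ "h n"] h[of n] in \<open>auto intro!: continuous_intros\<close>)
  have contS: "continuous_on ?P (s n)" for n
    unfolding s_def using h[of n] by (intro continuous_intros contP contPh) auto
  have AEoff: "AE x in lebesgue_on ?P. x \<in> off_grid T ?P"
    using T(1) by (intro AE_off_grid) auto
  have offsub: "off_grid T ?P \<subseteq> off_grid T ?S"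
    using sub by (auto simp: off_grid_def)
  have meas: "(\<lambda>x. frechet_derivative f (at x) i) \<in> borel_measurable (lebesgue_on ?P)"
    using piecewise_C1_derivative_measurable[OF pw open_box i]
    by (rule measurable_restrict_mono) (rule sub)
  have "(\<lambda>n. \<integral>x. s n x \<partial>lebesgue_on ?P) \<longlonglongrightarrow> (\<integral>x. frechet_derivative f (at x) i \<partial>lebesgue_on ?P)"
  proof (rule integral_dominated_convergence[where w = "\<lambda>_. B"])
    show "integrable (lebesgue_on ?P) (\<lambda>_. B)"
      by (rule integrable_lebesgue_on_bounded[where B = "\<bar>B\<bar>"]) auto
    show "s n \<in> borel_measurable (lebesgue_on ?P)" for n
      using contS by (rule continuous_imp_measurable_on_sets_lebesgue) simp
    show "AE x in lebesgue_on ?P. norm (s n x) \<le> B" for n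
      using AEoff
    proof eventually_elim
      case (elim x)
      then have "\<bar>f (x + h n *\<^sub>R i) - f x\<bar> \<le> B * h n"
        using T i h[of n] offsub
        by (intro piecewise_C1_line_bound[OF cont, of T]) (auto simp: off_grid_def intro!: shiftS)
      then show ?case
        using h(1)[of n] by (simp add: s_def field_simps)
    qed
    show "AE x in lebesgue_on ?P. (\<lambda>n. s n x) \<longlonglongrightarrow> frechet_derivative f (at x) i"
      using AEoff
    proof eventually_elim
      case (elim x)
      then have "f differentiable (at x)"
        using T(2) offsub by (auto simp: C1_open_def)
      \<comment> \<open>The base point is written \<open>x + 0 *\<^sub>R i\<close> to fit the chain
        rule for \<open>\<lambda>t. x + t *\<^sub>R i\<close> at 0.\<close>
      then have d: "(f has_derivative frechet_derivative f (at x)) (at (x + 0 *\<^sub>R i))"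
        by (simp add: frechet_derivative_works)
      have "((\<lambda>t. f (x + t *\<^sub>R i)) has_derivative (\<lambda>t. frechet_derivative f (at x) (t *\<^sub>R i))) (at 0)"
        by (rule has_derivative_compose[where f = "\<lambda>t. x + t *\<^sub>R i", OF _ d]) (auto intro!: derivative_eq_intros)
      moreover have "(\<lambda>t. frechet_derivative f (at x) (t *\<^sub>R i)) = (*) (frechet_derivative f (at x) i)"
        using has_derivative_linear[OF d] by (simp add: fun_eq_iff linear_scale)
      ultimately have "((\<lambda>t. f (x + t *\<^sub>R i)) has_field_derivative frechet_derivative f (at x) i) (at 0)"
        by (simp add: has_field_derivative_def)
      then have "(\<lambda>t. (f (x + t *\<^sub>R i) - f x) / t) \<midarrow>0\<rightarrow> frechet_derivative f (at x) i"
        by (simp add: DERIV_def)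
      moreover have "filterlim h (at 0) sequentially"
        using h_lim h(1) by (auto simp: filterlim_at less_imp_neq[symmetric])
      ultimately show ?case
        unfolding s_def by (rule filterlim_compose)
    qed
  qed (rule meas)
  moreover have "\<bar>\<integral>x. s n x \<partial>lebesgue_on ?P\<bar> \<le> 2 * e * ?A" for n
  proof -
    have "(\<integral>x. s n x \<partial>lebesgue_on ?P) = integral ?P (s n)"
      using contS by (intro lebesgue_integral_eq_integral continuous_imp_integrable) auto
    also have "\<dots> = (integral ?P (\<lambda>x. f (x + h n *\<^sub>R i)) - integral ?P f) / h n"
      unfolding s_def
      using integral_diff[OF integrable_continuous[OF contPh] integrable_continuous[OF contP], of n]
      by simp
    finally have eq: "(\<integral>x. s n x \<partial>lebesgue_on ?P) * h n =
        integral ?P (\<lambda>x. f (x + h n *\<^sub>R i)) - integral ?P f"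
      using h[of n] by simp
    have "\<bar>integral ?P (\<lambda>x. f (x + h n *\<^sub>R i)) - integral ?P f\<bar> \<le> 2 * e * h n * ?A"
    proof (rule integral_shift_difference_bound)
      show "continuous_on (cbox p (q + h n *\<^sub>R i)) f"
        using cont Qsub h[of n] by (meson continuous_on_subset less_imp_le)
      show "\<forall>x\<in>cbox p (q + h n *\<^sub>R i).
          x \<bullet> i \<le> p \<bullet> i + h n \<or> q \<bullet> i \<le> x \<bullet> i \<longrightarrow> \<bar>f x\<bar> \<le> e"
      proof (intro ballI impI)
        fix x assume x: "x \<in> cbox p (q + h n *\<^sub>R i)" "x \<bullet> i \<le> p \<bullet> i + h n \<or> q \<bullet> i \<le> x \<bullet> i"
        have "x \<in> ?S"
          using x(1) Qsub[of "h n"] h[of n] by auto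
        moreover have "p \<bullet> i \<le> x \<bullet> i" "x \<bullet> i \<le> q \<bullet> i + h n"
          using x(1) i by (auto simp: mem_box inner_simps)
        moreover have "h n \<le> \<delta>"
          using h(2)[of n] by (simp add: h0_def)
        ultimately show "\<bar>f x\<bar> \<le> e"
          using e x(2) by (smt (verit, best))
      qed
      show "h n \<le> q \<bullet> i - p \<bullet> i"
        using h(2)[of n] by (simp add: h0_def)
    qed (use pq i h[of n] \<open>e \<ge> 0\<close> in \<open>auto simp: less_imp_le\<close>)
    then have "\<bar>\<integral>x. s n x \<partial>lebesgue_on ?P\<bar> * h n \<le> (2 * e * ?A) * h n"
      unfolding eq[symmetric] using h(1)[of n] by (simp add: abs_mult mult_ac)
    then show ?thesis
      using h(1)[of n] by (rule mult_right_le_imp_le)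
  qed
  ultimately show ?thesis
    by (intro LIMSEQ_le_const2[OF tendsto_rabs]) auto
qed

section \<open>Finite element functions as piecewise C1 functions\<close>

lemma grid_point_inner:
  "i \<in> Basis \<Longrightarrow> grid_point a b N j \<bullet> i = a \<bullet> i + real (j i) * ((b \<bullet> i - a \<bullet> i) / real (N i))"
  by (simp add: grid_point_def inner_sum_left inner_Basis if_distrib sum.delta cong: if_cong)

text \<open>Take as grid the hyperplanes carrying the cell faces. A point off them is interior to a
  cell, where \<open>v\<close> equals a polynomial; the finitely many compact cells give common
  bounds.\<close>

lemma fe_space_imp_piecewise_C1:
  fixes a b :: "'a::euclidean_space"
  assumes "uniform_rect_partition a b \<E>" "v \<in> fe_space (box a b) \<E> k"
  shows "piecewise_C1 (box a b) v"
proof (cases "box a b = {}")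
  case True
  show ?thesis
    unfolding True
    by (rule piecewise_C1I[where T = "\<lambda>_. {}"]) (auto simp: off_grid_def C1_open_def)
next
  case False
  then have ab: "a \<bullet> i < b \<bullet> i" if "i \<in> Basis" for i
    using that by (auto simp: box_ne_empty)
  obtain N where N: "\<forall>i\<in>Basis. 0 < N i" and \<E>: "\<E> =
      {cbox (grid_point a b N j) (grid_point a b N (\<lambda>i. j i + 1)) | j. \<forall>i\<in>Basis. j i < N i}"
    using assms(1) unfolding uniform_rect_partition_def by blast
  define lo where "lo j = grid_point a b N j" for j
  define hi where "hi j = grid_point a b N (\<lambda>i. j i + 1)" for j
  define H where "H i = (b \<bullet> i - a \<bullet> i) / real (N i)" for i
  have H: "H i > 0" if "i \<in> Basis" for i
    using ab[OF that] N that by (simp add: H_def)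
  have lo: "lo j \<bullet> i = a \<bullet> i + real (j i) * H i" if "i \<in> Basis" for i j
    using that by (simp add: lo_def grid_point_inner H_def)
  have hi: "hi j \<bullet> i = a \<bullet> i + real (j i + 1) * H i" if "i \<in> Basis" for i j
    unfolding hi_def grid_point_inner[OF that] H_def ..
  \<comment> \<open>The multi-index of a cell containing \<open>x\<close>: rounding down puts each
    coordinate in the interval closed below and open above.\<close>
  define J where "J x i = nat \<lfloor>(x \<bullet> i - a \<bullet> i) / H i\<rfloor>" for x i
  define T where "T i = (\<lambda>m. a \<bullet> i + real m * H i) ` {..N i}" for i
  have J: "J x i < N i" "lo (J x) \<bullet> i \<le> x \<bullet> i" "x \<bullet> i < hi (J x) \<bullet> i"
    if "x \<in> box a b" "i \<in> Basis" for x i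
  proof -
    have x: "a \<bullet> i < x \<bullet> i" "x \<bullet> i < b \<bullet> i"
      using that by (auto simp: mem_box)
    let ?z = "(x \<bullet> i - a \<bullet> i) / H i"
    have z: "0 < ?z" "?z < real (N i)"
      using x H[OF that(2)] N that(2) ab[OF that(2)] by (auto simp: H_def field_simps)
    then have fl: "real (J x i) = of_int \<lfloor>?z\<rfloor>"
      by (simp add: J_def)
    show "J x i < N i"
      using z fl by linarith
    have "real (J x i) \<le> ?z" "?z < real (J x i + 1)"
      unfolding of_nat_add fl by linarith+
    then show "lo (J x) \<bullet> i \<le> x \<bullet> i" "x \<bullet> i < hi (J x) \<bullet> i"
      using H[OF that(2)] unfolding lo[OF that(2)] hi[OF that(2)] by (simp_all add: field_simps)
  qed
  have cell: "cbox (lo (J x)) (hi (J x)) \<in> \<E>" "x \<in> cbox (lo (J x)) (hi (J x))"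
    if "x \<in> box a b" for x
    using J[OF that] unfolding \<E> lo_def hi_def by (auto simp: mem_box less_imp_le)
  have cell_open: "x \<in> box (lo (J x)) (hi (J x))" if "x \<in> off_grid T (box a b)" for x
  proof -
    have x: "x \<in> box a b"
      using that by (simp add: off_grid_def)
    have "lo (J x) \<bullet> i \<noteq> x \<bullet> i" if "i \<in> Basis" for i
    proof
      assume "lo (J x) \<bullet> i = x \<bullet> i"
      then have "x \<bullet> i \<in> T i"
        using J(1)[OF x that] lo[OF that, of "J x"] unfolding T_def
          by (intro image_eqI[where x = "J x i"]) auto
      then show False
        using \<open>x \<in> off_grid T (box a b)\<close> that by (auto simp: off_grid_def)
    qed
    then show ?thesis
      using J(2,3)[OF x] by (auto simp: mem_box order_less_le)
  qed
  \<comment> \<open>The description of \<open>\<E>\<close> lets \<open>j\<close> range over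
    functions on the whole space. Restricting \<open>j\<close> to \<open>Basis\<close> leaves the
    corners unchanged and only finitely many choices.\<close>
  have "finite \<E>"
  proof (rule finite_subset)
    show "\<E> \<subseteq> (\<lambda>j. cbox (lo j) (hi j)) ` (Basis \<rightarrow>\<^sub>E {..<Max (N ` Basis)})"
    proof
      fix E assume "E \<in> \<E>"
      then obtain j where j: "E = cbox (lo j) (hi j)" "\<forall>i\<in>Basis. j i < N i"
        unfolding \<E> lo_def hi_def by blast
      let ?j = "restrict j Basis"
      have "lo ?j = lo j" "hi ?j = hi j"
        by (rule euclidean_eqI; simp add: lo hi)+
      moreover have "j i < Max (N ` Basis)" if "i \<in> Basis" for i
        using j(2) that by (meson Max_ge finite_Basis finite_imageI imageI less_le_trans)
      then have "?j \<in> Basis \<rightarrow>\<^sub>E {..<Max (N ` Basis)}"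
        by auto
      ultimately show "E \<in> (\<lambda>j. cbox (lo j) (hi j)) ` (Basis \<rightarrow>\<^sub>E {..<Max (N ` Basis)})"
        using j(1) by (intro image_eqI[where x = ?j]) simp_all
    qed
    show "finite ((\<lambda>j. cbox (lo j) (hi j)) ` (Basis \<rightarrow>\<^sub>E {..<Max (N ` Basis)}))"
      by (intro finite_imageI finite_PiE) auto
  qed
  have v: "continuous_on (box a b) v" "\<forall>E\<in>\<E>. \<exists>p\<in>Qk k. \<forall>x\<in>E. v x = p x"
    using assms(2) by (auto simp: fe_space_def)
  then obtain p where p: "\<forall>E\<in>\<E>. p E \<in> Qk k \<and> (\<forall>x\<in>E. v x = p E x)"
    by metis
  have C1: "C1_open UNIV (p E)" if "E \<in> \<E>" for E
    using p that C1_open_Qk by blast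
  have "\<forall>E\<in>\<E>. \<exists>B. \<forall>x\<in>E. \<bar>p E x\<bar> \<le> B \<and> (\<forall>i\<in>Basis. \<bar>frechet_derivative (p E) (at x) i\<bar> \<le> B)"
  proof
    fix E assume "E \<in> \<E>"
    then have "compact E"
      by (auto simp: \<E>)
    from C1_open_bounded_on_compact[OF C1[OF \<open>E \<in> \<E>\<close>] this subset_UNIV]
    show "\<exists>B. \<forall>x\<in>E. \<bar>p E x\<bar> \<le> B \<and> (\<forall>i\<in>Basis. \<bar>frechet_derivative (p E) (at x) i\<bar> \<le> B)"
      by metis
  qed
  then obtain B where B: "\<forall>E\<in>\<E>. \<forall>x\<in>E. \<bar>p E x\<bar> \<le> B E \<and>
      (\<forall>i\<in>Basis. \<bar>frechet_derivative (p E) (at x) i\<bar> \<le> B E)"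
    by metis
  \<comment> \<open>Each cell has its own bound; the sum over the finite \<open>\<E>\<close> is one
    bound for all.\<close>
  define C where "C = (\<Sum>E\<in>\<E>. \<bar>B E\<bar>)"
  have C: "B E \<le> C" if "E \<in> \<E>" for E
    using member_le_sum[of E \<E> "\<lambda>E. \<bar>B E\<bar>"] that \<open>finite \<E>\<close> by (auto simp: C_def)
  define pc where "pc x = p (cbox (lo (J x)) (hi (J x)))" for x
  have eq: "v y = pc x y" if "x \<in> box a b" "y \<in> box (lo (J x)) (hi (J x))" for x y
    using p cell(1)[OF that(1)] that(2) box_subset_cbox unfolding pc_def by blast
  show ?thesis
  proof (rule piecewise_C1I[where T = T and B = C and C = C])
    fix x assume x: "x \<in> box a b"
    then show "\<bar>v x\<bar> \<le> C"
      using p B C cell[OF x] by (metis order_trans)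
  next
    show "C1_open (off_grid T (box a b)) v"
    proof (rule C1_open_local)
      fix x assume x: "x \<in> off_grid T (box a b)"
      then have "x \<in> box a b"
        by (simp add: off_grid_def)
      then show "\<exists>W p. open W \<and> x \<in> W \<and> C1_open UNIV p \<and> (\<forall>y\<in>W. v y = p y)"
        using cell_open[OF x] eq C1[OF cell(1)] unfolding pc_def by blast
    qed
  next
    fix x i assume x: "x \<in> off_grid T (box a b)" and i: "i \<in> (Basis::'a set)"
    then have "x \<in> box a b"
      by (simp add: off_grid_def)
    have "frechet_derivative v (at x) = frechet_derivative (pc x) (at x)"
      by (rule frechet_derivative_eq_on_open[OF open_box cell_open[OF x] eq[OF \<open>x \<in> box a b\<close>]])
    moreover have "\<bar>frechet_derivative (pc x) (at x) i\<bar> \<le> B (cbox (lo (J x)) (hi (J x)))"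
      using B cell[OF \<open>x \<in> box a b\<close>] i unfolding pc_def by blast
    ultimately show "\<bar>frechet_derivative v (at x) i\<bar> \<le> C"
      using C[OF cell(1)[OF \<open>x \<in> box a b\<close>]] by simp
  qed (use v in \<open>auto simp: T_def\<close>)
qed

lemma frechet_derivative_inner:
  assumes "F differentiable (at x)"
  shows "frechet_derivative (\<lambda>x. F x \<bullet> i) (at x) h = frechet_derivative F (at x) h \<bullet> i"
proof -
  have "((\<lambda>x. F x \<bullet> i) has_derivative (\<lambda>h. frechet_derivative F (at x) h \<bullet> i)) (at x)"
    using assms by (intro has_derivative_inner_left) (simp add: frechet_derivative_works)
  from frechet_derivative_at[OF this] show ?thesis
    by metis
qed

lemma C1_open_inner:
  assumes "C1_open S F"
  shows "C1_open S (\<lambda>x. F x \<bullet> i)"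
proof -
  have "continuous_on S (\<lambda>x. frechet_derivative F (at x) j \<bullet> i)" if "j \<in> Basis" for j
    using assms that by (intro continuous_intros) (auto simp: C1_open_def)
  then show ?thesis
    using assms unfolding C1_open_def
    by (auto simp: frechet_derivative_inner cong: continuous_on_cong)
qed

section \<open>Integration by parts on a box\<close>

text \<open>Moving \<open>x\<close> along \<open>i\<close> onto the nearby face lands in its
  relative interior, because the other coordinates stay strictly inside; so the normal there exists
  and is \<open>i\<close> or \<open>- i\<close>. The component vanishes at that point, and uniform
  continuity on the closed box makes \<delta> independent of \<open>x\<close>.\<close>

lemma normal_component_small_near_boundary:
  fixes F :: "'a::euclidean_space \<Rightarrow> 'a"
  assumes "continuous_on (cbox a b) F" "e > 0"
    and normal: "\<forall>x\<in>frontier (box a b). \<forall>n. outward_unit_normal a b x n \<longrightarrow> F x \<bullet> n = 0"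
  obtains \<delta> where "\<delta> > 0"
    "\<forall>x\<in>box a b. \<forall>i\<in>Basis. x \<bullet> i < a \<bullet> i + \<delta> \<or> b \<bullet> i - \<delta> < x \<bullet> i \<longrightarrow> \<bar>F x \<bullet> i\<bar> \<le> e"
proof -
  have "uniformly_continuous_on (cbox a b) F"
    using assms(1) by (simp add: compact_uniformly_continuous)
  then obtain \<delta> where \<delta>: "\<delta> > 0"
    "\<forall>x\<in>cbox a b. \<forall>y\<in>cbox a b. dist y x < \<delta> \<longrightarrow> dist (F y) (F x) < e"
    using \<open>e > 0\<close> unfolding uniformly_continuous_on_def by metis
  have "\<bar>F x \<bullet> i\<bar> \<le> e"
    if x: "x \<in> box a b" and i: "i \<in> Basis" and near: "x \<bullet> i < a \<bullet> i + \<delta> \<or> b \<bullet> i - \<delta> < x \<bullet> i" for x i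
  proof -
    \<comment> \<open>The coordinate of the face to project onto: the lower one if both are
      near.\<close>
    define s where "s = (if x \<bullet> i < a \<bullet> i + \<delta> then a \<bullet> i else b \<bullet> i)"
    define y where "y = x + (s - x \<bullet> i) *\<^sub>R i"
    have y: "y \<bullet> j = (if j = i then s else x \<bullet> j)" if "j \<in> Basis" for j
      using that i by (auto simp: y_def inner_simps inner_Basis)
    have xab: "a \<bullet> j < x \<bullet> j" "x \<bullet> j < b \<bullet> j" if "j \<in> Basis" for j
      using x that by (auto simp: mem_box)
    have "y \<in> cbox a b"
      using xab xab[OF i] by (auto simp: mem_box y s_def less_imp_le)
    moreover have "y \<notin> box a b"
      using i by (auto simp: mem_box y s_def)
    moreover have "frontier (box a b) = cbox a b - box a b"
      using x by (auto simp: frontier_box)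
    ultimately have "y \<in> frontier (box a b)"
      by blast
    moreover have "outward_unit_normal a b y i \<or> outward_unit_normal a b y (- i)"
      using i xab unfolding outward_unit_normal_def by (auto simp: y s_def)
    ultimately have "F y \<bullet> i = 0"
      using normal by fastforce
    have "dist y x = \<bar>s - x \<bullet> i\<bar>"
      using i by (simp add: y_def dist_norm)
    also have "\<dots> < \<delta>"
      using near xab[OF i] by (auto simp: s_def)
    finally have "dist (F y) (F x) < e"
      using \<delta>(2) \<open>y \<in> cbox a b\<close> x box_subset_cbox by blast
    moreover have "\<bar>(F y - F x) \<bullet> i\<bar> \<le> norm (F y - F x)"
      using i by (rule Basis_le_norm)
    ultimately show ?thesis
      using \<open>F y \<bullet> i = 0\<close> by (simp add: dist_norm inner_diff_left)
  qed
  with \<delta>(1) that show ?thesis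
    by blast
qed

section \<open>Measurability and integrability of gradients, and the integration by parts
  formula\<close>

text \<open>Gives access to the limit theorem for integrals over an increasing sequence of sets,
  which speaks of set integrals.\<close>

lemma set_integrable_lebesgue_on:
  fixes G :: "'a::euclidean_space \<Rightarrow> real"
  assumes "S \<in> sets lebesgue"
  shows "integrable (lebesgue_on S) G \<longleftrightarrow> set_integrable lebesgue S G"
    and "(\<integral>x. G x \<partial>lebesgue_on S) = set_lebesgue_integral lebesgue S G"
  using assms
  by (simp_all add: integrable_restrict_space integral_restrict_space set_integrable_def
      set_lebesgue_integral_def)

lemma grad_inner: "i \<in> Basis \<Longrightarrow> grad f x \<bullet> i = frechet_derivative f (at x) i"
  by (simp add: grad_def inner_sum_left inner_Basis if_distrib sum.delta cong: if_cong)

lemma inner_grad: "v \<bullet> grad f x = (\<Sum>i\<in>Basis. (v \<bullet> i) * frechet_derivative f (at x) i)"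
  by (subst euclidean_inner) (simp add: grad_inner)

lemma piecewise_C1_grad_measurable:
  assumes "piecewise_C1 S f" "open S"
  shows "grad f \<in> borel_measurable (lebesgue_on S)"
  unfolding grad_def[abs_def]
  by (intro borel_measurable_sum borel_measurable_scaleR piecewise_C1_derivative_measurable[OF assms])
    auto

lemma piecewise_C1_grad_AE_bound:
  assumes "piecewise_C1 S f" "open S"
  obtains B where "AE x in lebesgue_on S. norm (grad f x) \<le> B"
proof -
  obtain B where "AE x in lebesgue_on S. f differentiable (at x) \<and>
      (\<forall>i\<in>Basis. \<bar>frechet_derivative f (at x) i\<bar> \<le> B)"
    by (rule piecewise_C1_AE_bound[OF assms]) (rule that)
  then have "AE x in lebesgue_on S. norm (grad f x) \<le> of_nat DIM('a) * B"
  proof eventually_elim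
    case (elim x)
    have "norm (grad f x) \<le> (\<Sum>i\<in>Basis. \<bar>grad f x \<bullet> i\<bar>)"
      by (rule norm_le_l1)
    also have "\<dots> \<le> of_nat DIM('a) * B"
      using elim by (intro sum_bounded_above) (auto simp: grad_inner)
    finally show ?case .
  qed
  then show ?thesis
    by (rule that)
qed

lemma piecewise_C1_derivative_integrable:
  fixes f :: "'a::euclidean_space \<Rightarrow> real"
  assumes "piecewise_C1 S f" "open S" "P \<subseteq> S" "P \<in> lmeasurable" "i \<in> Basis"
  shows "integrable (lebesgue_on P) (\<lambda>x. frechet_derivative f (at x) i)"
proof -
  obtain B where "AE x in lebesgue_on S. f differentiable (at x) \<and>
      (\<forall>i\<in>Basis. \<bar>frechet_derivative f (at x) i\<bar> \<le> B)"
    by (rule piecewise_C1_AE_bound[OF assms(1,2)]) (rule that)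
  then have "AE x in lebesgue. x \<in> S \<longrightarrow> \<bar>frechet_derivative f (at x) i\<bar> \<le> B"
    using assms(2,5) by (auto simp: AE_restrict_space_iff)
  then have "AE x in lebesgue. x \<in> P \<longrightarrow> \<bar>frechet_derivative f (at x) i\<bar> \<le> B"
    by eventually_elim (use assms(3) in auto)
  then have "AE x in lebesgue_on P. norm (frechet_derivative f (at x) i) \<le> B"
    using assms(4) by (simp add: AE_restrict_space_iff fmeasurableD)
  moreover have "(\<lambda>x. frechet_derivative f (at x) i) \<in> borel_measurable (lebesgue_on P)"
    using piecewise_C1_derivative_measurable[OF assms(1,2,5)]
    by (rule measurable_restrict_mono) (rule assms(3))
  ultimately show ?thesis
    using assms(4) by (intro integrable_lebesgue_on_bounded)
qed

lemma integrable_inner_grad: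
  fixes F :: "'a::euclidean_space \<Rightarrow> 'a"
  assumes "continuous_on (cbox a b) F" "piecewise_C1 (box a b) \<psi>"
  shows "integrable (lebesgue_on (box a b)) (\<lambda>x. F x \<bullet> grad \<psi> x)"
proof -
  have "bounded (F ` cbox a b)"
    using assms(1) by (intro compact_imp_bounded compact_continuous_image) auto
  then obtain C where C: "\<forall>x\<in>cbox a b. norm (F x) \<le> C"
    by (auto simp: bounded_iff)
  obtain B where "AE x in lebesgue_on (box a b). norm (grad \<psi> x) \<le> B"
    by (rule piecewise_C1_grad_AE_bound[OF assms(2) open_box]) (rule that)
  moreover have "AE x in lebesgue_on (box a b). x \<in> box a b"
    using AE_space[of "lebesgue_on (box a b)"] by simp
  ultimately have "AE x in lebesgue_on (box a b). norm (F x \<bullet> grad \<psi> x) \<le> C * B"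
  proof eventually_elim
    case (elim x)
    then have "norm (F x) \<le> C"
      using C box_subset_cbox by blast
    have "norm (F x \<bullet> grad \<psi> x) \<le> norm (F x) * norm (grad \<psi> x)"
      by (simp add: Cauchy_Schwarz_ineq2)
    also have "\<dots> \<le> C * B"
      using elim \<open>norm (F x) \<le> C\<close> by (intro mult_mono) (auto intro: order_trans[OF norm_ge_zero])
    finally show ?case .
  qed
  moreover have "F \<in> borel_measurable (lebesgue_on (box a b))"
    by (rule continuous_imp_measurable_on_sets_lebesgue)
      (simp_all add: continuous_on_subset[OF assms(1) box_subset_cbox])
  ultimately show ?thesis
    using piecewise_C1_grad_measurable[OF assms(2) open_box]
    by (intro integrable_lebesgue_on_bounded borel_measurable_inner) auto
qed

text \<open>Almost everywhere, \<open>G\<close> is the divergence of \<psi> times \<open>F\<close>.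
  Both summands of \<open>G\<close> are integrable over the whole box, so its integral is the limit
  of those over \<open>P n\<close>. Only there is the divergence split into single partial
  derivatives, each controlled by the face estimate.\<close>

lemma integration_by_parts_box:
  fixes F :: "'a::euclidean_space \<Rightarrow> 'a"
  assumes ab: "box a b \<noteq> {}"
    and F: "C1_open (box a b) F" "continuous_on (cbox a b) F"
    and normal: "\<forall>x\<in>frontier (box a b). \<forall>n. outward_unit_normal a b x n \<longrightarrow> F x \<bullet> n = 0"
    and \<psi>: "piecewise_C1 (box a b) \<psi>"
    and div: "integrable (lebesgue_on (box a b)) (\<lambda>x. \<psi> x * divergence F x)"
  shows "(\<integral>x. F x \<bullet> grad \<psi> x \<partial>lebesgue_on (box a b))
    = - (\<integral>x. \<psi> x * divergence F x \<partial>lebesgue_on (box a b))"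
proof -
  let ?\<Omega> = "box a b"
  define f where "f i x = \<psi> x * (F x \<bullet> i)" for i x
  define G where "G x = F x \<bullet> grad \<psi> x + \<psi> x * divergence F x" for x
  define w where "w = b - a"
  define p where "p \<eta> = a + \<eta> *\<^sub>R w" for \<eta> :: real
  define q where "q \<eta> = b - \<eta> *\<^sub>R w" for \<eta> :: real
  \<comment> \<open>The shift by 3 keeps \<open>\<eta> n\<close> below one half, so that opposite
    faces of the inner boxes do not cross.\<close>
  define \<eta> where "\<eta> n = 1 / real (n + 3)" for n :: nat
  have w: "w \<bullet> i > 0" if "i \<in> Basis" for i
    using ab that by (auto simp: w_def box_ne_empty inner_simps)
  have pi: "p t \<bullet> i = a \<bullet> i + t * (w \<bullet> i)" and qi: "q t \<bullet> i = b \<bullet> i - t * (w \<bullet> i)" for t i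
    by (auto simp: p_def q_def inner_simps)
  have bi: "b \<bullet> i = a \<bullet> i + w \<bullet> i" for i
    by (simp add: w_def inner_simps)
  have \<eta>: "0 < \<eta> n" "\<eta> n < 1/2" for n
    by (auto simp: \<eta>_def field_simps)
  have \<eta>_lim: "\<eta> \<longlonglongrightarrow> 0"
    unfolding \<eta>_def using LIMSEQ_ignore_initial_segment[OF lim_1_over_n, of 3] by simp
  have \<eta>_mono: "\<eta> n \<le> \<eta> m" if "m \<le> n" for m n
    using that by (auto simp: \<eta>_def field_simps)
  \<comment> \<open>The chain is
    \<open>P n \<subseteq> S n \<subseteq> K n \<subseteq> box a b\<close>: the integral runs over
    \<open>P n\<close>, the difference quotients have room in the open \<open>S n\<close>, and the
    compact \<open>K n\<close> bounds the derivatives of \<open>F\<close>.\<close>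
  define P where "P n = cbox (p (\<eta> n)) (q (\<eta> n))" for n
  define S where "S n = box (p (\<eta> n / 2)) (q (\<eta> n / 2))" for n
  define K where "K n = cbox (p (\<eta> n / 2)) (q (\<eta> n / 2))" for n
  have PS: "P n \<subseteq> S n" for n
  proof
    fix x assume "x \<in> P n"
    moreover have "p (\<eta> n / 2) \<bullet> i < p (\<eta> n) \<bullet> i" "q (\<eta> n) \<bullet> i < q (\<eta> n / 2) \<bullet> i" if "i \<in> Basis" for i
      using w[OF that] \<eta>[of n] by (auto simp: pi qi)
    ultimately show "x \<in> S n"
      by (auto simp: P_def S_def mem_box) (meson less_le_trans le_less_trans)+
  qed
  have SK: "S n \<subseteq> K n" for n
    by (simp add: S_def K_def box_subset_cbox)
  have K\<Omega>: "K n \<subseteq> ?\<Omega>" for n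
  proof
    fix x assume "x \<in> K n"
    moreover have "a \<bullet> i < p (\<eta> n / 2) \<bullet> i" "q (\<eta> n / 2) \<bullet> i < b \<bullet> i" if "i \<in> Basis" for i
      using w[OF that] \<eta>[of n] by (auto simp: pi qi)
    ultimately show "x \<in> ?\<Omega>"
      by (auto simp: K_def mem_box) (meson less_le_trans le_less_trans)+
  qed
  have P\<Omega>: "P n \<subseteq> ?\<Omega>" for n
    using PS SK K\<Omega> by blast
  have "incseq P"
  proof (rule incseq_SucI, rule subsetI)
    fix n x assume "x \<in> P n"
    moreover have "\<eta> (Suc n) * (w \<bullet> i) \<le> \<eta> n * (w \<bullet> i)" if "i \<in> Basis" for i
      using w[OF that] \<eta>_mono[of n "Suc n"] by (simp add: mult_right_mono less_imp_le)
    ultimately show "x \<in> P (Suc n)"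
      by (fastforce simp: P_def mem_box pi qi)
  qed
  have UnP: "(\<Union>n. P n) = ?\<Omega>"
  proof (rule antisym)
    show "?\<Omega> \<subseteq> (\<Union>n. P n)"
    proof
      fix x assume x: "x \<in> ?\<Omega>"
      then have x': "0 < x \<bullet> i - a \<bullet> i" "0 < b \<bullet> i - x \<bullet> i" if "i \<in> Basis" for i
        using that by (auto simp: mem_box)
      have "\<forall>\<^sub>F n in sequentially. \<forall>i\<in>Basis. \<eta> n * (w \<bullet> i) < x \<bullet> i - a \<bullet> i \<and> \<eta> n * (w \<bullet> i) < b \<bullet> i - x \<bullet> i"
      proof (intro eventually_ball_finite ballI eventually_conj)
        fix i :: 'a assume i: "i \<in> Basis"
        have "(\<lambda>n. \<eta> n * (w \<bullet> i)) \<longlonglongrightarrow> 0"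
          using \<eta>_lim by (rule tendsto_mult_left_zero)
        then show "\<forall>\<^sub>F n in sequentially. \<eta> n * (w \<bullet> i) < x \<bullet> i - a \<bullet> i"
          "\<forall>\<^sub>F n in sequentially. \<eta> n * (w \<bullet> i) < b \<bullet> i - x \<bullet> i"
          using x'[OF i] by (simp_all only: order_tendstoD(2))
      qed auto
      from eventually_happens'[OF sequentially_bot this]
      obtain n where "\<forall>i\<in>Basis. \<eta> n * (w \<bullet> i) < x \<bullet> i - a \<bullet> i \<and> \<eta> n * (w \<bullet> i) < b \<bullet> i - x \<bullet> i"
        by (rule exE)
      then have "x \<in> P n"
        by (fastforce simp: P_def mem_box pi qi)
      then show "x \<in> (\<Union>n. P n)"
        by blast
    qed
  qed (use P\<Omega> in blast)
  have int_grad: "integrable (lebesgue_on ?\<Omega>) (\<lambda>x. F x \<bullet> grad \<psi> x)"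
    using F(2) \<psi> by (rule integrable_inner_grad)
  then have intG: "integrable (lebesgue_on ?\<Omega>) G"
    unfolding G_def using div by (rule Bochner_Integration.integrable_add)
  have lim: "(\<lambda>n. \<integral>x. G x \<partial>lebesgue_on (P n)) \<longlonglongrightarrow> (\<integral>x. G x \<partial>lebesgue_on ?\<Omega>)"
  proof -
    have P_sets: "P n \<in> sets lebesgue" for n
      by (simp add: P_def)
    have "(\<lambda>n. LINT x:P n|lebesgue. G x) \<longlonglongrightarrow> (LINT x:(\<Union>n. P n)|lebesgue. G x)"
      using \<open>incseq P\<close> intG
      by (intro set_integral_cont_up) (simp_all add: UnP set_integrable_lebesgue_on(1) P_sets)
    then show ?thesis
      by (simp add: set_integrable_lebesgue_on(2) UnP P_sets)
  qed
  have pw: "piecewise_C1 (S n) (f i)" for n i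
  proof -
    have "piecewise_C1 (S n) \<psi>"
      using \<psi> SK K\<Omega> by (blast intro: piecewise_C1_subset)
    moreover have "piecewise_C1 (S n) (\<lambda>x. F x \<bullet> i)"
      using C1_open_inner[OF F(1)] SK K\<Omega>
      by (intro piecewise_C1_on_compact_subset[where K = "K n" and U = ?\<Omega>]) (auto simp: K_def)
    ultimately show ?thesis
      unfolding f_def by (rule piecewise_C1_mult)
  qed
  obtain B where B: "B \<ge> 0" "\<forall>x\<in>?\<Omega>. \<bar>\<psi> x\<bar> \<le> B"
    "AE x in lebesgue_on ?\<Omega>. \<psi> differentiable (at x) \<and>
      (\<forall>i\<in>Basis. \<bar>frechet_derivative \<psi> (at x) i\<bar> \<le> B)"
    by (rule piecewise_C1_AE_bound[OF \<psi> open_box]) (rule that)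
  \<comment> \<open>This is the product rule, valid wherever \<psi> is differentiable.\<close>
  have AE_G: "AE x in lebesgue_on (P n). G x = (\<Sum>i\<in>Basis. frechet_derivative (f i) (at x) i)" for n
  proof -
    have "AE x in lebesgue. x \<in> ?\<Omega> \<longrightarrow> \<psi> differentiable (at x)"
      using B(3) by (auto simp: AE_restrict_space_iff)
    then have "AE x in lebesgue. x \<in> P n \<longrightarrow> G x = (\<Sum>i\<in>Basis. frechet_derivative (f i) (at x) i)"
    proof eventually_elim
      case (elim x)
      show ?case
      proof
        assume "x \<in> P n"
        then have x: "x \<in> ?\<Omega>"
          using P\<Omega> by blast
        then have d: "\<psi> differentiable (at x)" "F differentiable (at x)"
          using elim F(1) by (auto simp: C1_open_def)
        then have "(\<lambda>x. F x \<bullet> i) differentiable (at x)" for i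
          using C1_open_inner[OF F(1)] x by (auto simp: C1_open_def)
        then have "frechet_derivative (f i) (at x) i =
            \<psi> x * (frechet_derivative F (at x) i \<bullet> i) + frechet_derivative \<psi> (at x) i * (F x \<bullet> i)" for i
          unfolding f_def using d by (simp add: frechet_derivative_mult_real frechet_derivative_inner)
        then show "G x = (\<Sum>i\<in>Basis. frechet_derivative (f i) (at x) i)"
          by (simp add: G_def inner_grad divergence_def sum.distrib sum_distrib_left mult.commute)
      qed
    qed
    then show ?thesis
      by (simp add: AE_restrict_space_iff P_def)
  qed
  have int_f: "integrable (lebesgue_on (P n)) (\<lambda>x. frechet_derivative (f i) (at x) i)" if "i \<in> Basis" for n i
    using pw[of n i] PS[of n] that
    by (intro piecewise_C1_derivative_integrable[where S = "S n"]) (auto simp: S_def P_def)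
  have G_sum: "(\<integral>x. G x \<partial>lebesgue_on (P n)) =
      (\<Sum>i\<in>Basis. \<integral>x. frechet_derivative (f i) (at x) i \<partial>lebesgue_on (P n))" for n
  proof -
    have "G \<in> borel_measurable (lebesgue_on ?\<Omega>)"
      using intG by (rule borel_measurable_integrable)
    then have "G \<in> borel_measurable (lebesgue_on (P n))"
      by (rule measurable_restrict_mono) (rule P\<Omega>)
    then have "(\<integral>x. G x \<partial>lebesgue_on (P n)) =
        (\<integral>x. (\<Sum>i\<in>Basis. frechet_derivative (f i) (at x) i) \<partial>lebesgue_on (P n))"
      using AE_G int_f by (intro integral_cong_AE borel_measurable_sum) auto
    also have "\<dots> = (\<Sum>i\<in>Basis. \<integral>x. frechet_derivative (f i) (at x) i \<partial>lebesgue_on (P n))"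
      using int_f by (rule Bochner_Integration.integral_sum)
    finally show ?thesis .
  qed
  \<comment> \<open>Independent of \<open>n\<close> and \<open>e\<close>: the edge lengths of the
    whole box replace the smaller ones of \<open>P n\<close>.\<close>
  define C where "C = (\<Sum>i\<in>Basis. 2 * B * (\<Prod>j\<in>Basis - {i}. w \<bullet> j))"
  have "C \<ge> 0"
    unfolding C_def using B(1) w by (intro sum_nonneg mult_nonneg_nonneg prod_nonneg) (auto simp: less_imp_le)
  have bound: "\<bar>\<integral>x. G x \<partial>lebesgue_on ?\<Omega>\<bar> \<le> C * e" if "e > 0" for e
  proof -
    obtain \<delta> where \<delta>: "\<delta> > 0" 
      "\<forall>x\<in>box a b. \<forall>i\<in>Basis. x \<bullet> i < a \<bullet> i + \<delta> \<or> b \<bullet> i - \<delta> < x \<bullet> i \<longrightarrow> \<bar>F x \<bullet> i\<bar> \<le> e"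
      by (rule normal_component_small_near_boundary[OF F(2) \<open>e > 0\<close> normal]) (rule that)
    have "(\<lambda>n. \<eta> n * norm w) \<longlonglongrightarrow> 0"
      using \<eta>_lim by (rule tendsto_mult_left_zero)
    \<comment> \<open>The faces of \<open>P n\<close> are then within half of \<delta> of those of
      the whole box, so a point within the other half of a face of \<open>P n\<close> is in the
      region where \<open>F \<bullet> i\<close> is small.\<close>
    then have "\<forall>\<^sub>F n in sequentially. \<eta> n * norm w < \<delta> / 2"
      using \<open>\<delta> > 0\<close> by (intro order_tendstoD(2)) auto
    then have "\<forall>\<^sub>F n in sequentially. \<bar>\<integral>x. G x \<partial>lebesgue_on (P n)\<bar> \<le> C * e"
    proof eventually_elim
      case (elim n)
      have "\<bar>\<integral>x. frechet_derivative (f i) (at x) i \<partial>lebesgue_on (P n)\<bar>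
          \<le> 2 * (B * e) * (\<Prod>j\<in>Basis - {i}. w \<bullet> j)" if i: "i \<in> Basis" for i
      proof -
        have "\<bar>\<integral>x. frechet_derivative (f i) (at x) i \<partial>lebesgue_on (P n)\<bar>
          \<le> 2 * (B * e) * (\<Prod>j\<in>Basis - {i}. q (\<eta> n) \<bullet> j - p (\<eta> n) \<bullet> j)"
          unfolding P_def
        proof (rule piecewise_C1_integral_derivative_bound[OF pw[unfolded S_def] _ _ i])
          show "cbox (p (\<eta> n)) (q (\<eta> n)) \<subseteq> box (p (\<eta> n / 2)) (q (\<eta> n / 2))"
            using PS[of n] by (simp add: P_def S_def)
          show "\<forall>j\<in>Basis. p (\<eta> n) \<bullet> j < q (\<eta> n) \<bullet> j"
          proof
            fix j :: 'a assume "j \<in> Basis"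
            then have "\<eta> n * (w \<bullet> j) < 1/2 * (w \<bullet> j)"
              using w \<eta>(2)[of n] by (intro mult_strict_right_mono) auto
            then show "p (\<eta> n) \<bullet> j < q (\<eta> n) \<bullet> j"
              by (simp add: pi qi bi)
          qed
          show "\<delta> / 2 > 0"
            using \<open>\<delta> > 0\<close> by simp
          show "\<forall>x\<in>box (p (\<eta> n / 2)) (q (\<eta> n / 2)). \<bar>x \<bullet> i - p (\<eta> n) \<bullet> i\<bar> \<le> \<delta> / 2 \<or>
              \<bar>x \<bullet> i - q (\<eta> n) \<bullet> i\<bar> \<le> \<delta> / 2 \<longrightarrow> \<bar>f i x\<bar> \<le> B * e"
          proof (intro ballI impI)
            fix x assume x: "x \<in> box (p (\<eta> n / 2)) (q (\<eta> n / 2))"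
              and near: "\<bar>x \<bullet> i - p (\<eta> n) \<bullet> i\<bar> \<le> \<delta> / 2 \<or> \<bar>x \<bullet> i - q (\<eta> n) \<bullet> i\<bar> \<le> \<delta> / 2"
            have x: "x \<in> ?\<Omega>"
              using x SK[of n] K\<Omega>[of n] by (auto simp: S_def)
            have "\<eta> n * (w \<bullet> i) \<le> \<eta> n * norm w"
              using \<eta>[of n] Basis_le_norm[OF i, of w] by (intro mult_left_mono) auto
            then have "x \<bullet> i < a \<bullet> i + \<delta> \<or> b \<bullet> i - \<delta> < x \<bullet> i"
              using near elim unfolding pi qi by linarith
            then have "\<bar>F x \<bullet> i\<bar> \<le> e"
              using \<delta>(2) x i by blast
            then show "\<bar>f i x\<bar> \<le> B * e"
              unfolding f_def abs_mult using B x by (intro mult_mono) auto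
          qed
        qed
        also have "\<dots> \<le> 2 * (B * e) * (\<Prod>j\<in>Basis - {i}. w \<bullet> j)"
        proof (intro mult_left_mono prod_mono conjI)
          fix j :: 'a assume "j \<in> Basis - {i}"
          then have "0 < \<eta> n * (w \<bullet> j)" "\<eta> n * (w \<bullet> j) < 1/2 * (w \<bullet> j)"
            using w \<eta>[of n] by (auto intro!: mult_strict_right_mono)
          then show "0 \<le> q (\<eta> n) \<bullet> j - p (\<eta> n) \<bullet> j" "q (\<eta> n) \<bullet> j - p (\<eta> n) \<bullet> j \<le> w \<bullet> j"
            unfolding pi qi bi by linarith+
        qed (use B(1) \<open>e > 0\<close> in auto)
        finally show ?thesis .
      qed
      then have "\<bar>\<integral>x. G x \<partial>lebesgue_on (P n)\<bar> \<le> (\<Sum>i\<in>Basis. 2 * (B * e) * (\<Prod>j\<in>Basis - {i}. w \<bullet> j))"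
        unfolding G_sum by (intro order_trans[OF sum_abs] sum_mono)
      also have "\<dots> = C * e"
        by (simp add: C_def sum_distrib_right sum_distrib_left mult_ac)
      finally show ?case .
    qed
    then show ?thesis
      by (rule tendsto_upperbound[OF tendsto_rabs[OF lim]]) simp
  qed
  have "\<bar>\<integral>x. G x \<partial>lebesgue_on ?\<Omega>\<bar> \<le> 0"
  proof (rule field_le_epsilon)
    fix e :: real assume "e > 0"
    \<comment> \<open>The denominator \<open>C + 1\<close> also covers \<open>C = 0\<close>.\<close>
    have "\<bar>\<integral>x. G x \<partial>lebesgue_on ?\<Omega>\<bar> \<le> C * (e / (C + 1))"
      using \<open>C \<ge> 0\<close> \<open>e > 0\<close> by (intro bound) auto
    also have "\<dots> \<le> e"
      using \<open>C \<ge> 0\<close> \<open>e > 0\<close> by (simp add: field_simps)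
    finally show "\<bar>\<integral>x. G x \<partial>lebesgue_on ?\<Omega>\<bar> \<le> 0 + e"
      by simp
  qed
  moreover have "(\<integral>x. G x \<partial>lebesgue_on ?\<Omega>) = (\<integral>x. F x \<bullet> grad \<psi> x \<partial>lebesgue_on ?\<Omega>)
      + (\<integral>x. \<psi> x * divergence F x \<partial>lebesgue_on ?\<Omega>)"
    unfolding G_def using int_grad div by (rule Bochner_Integration.integral_add)
  ultimately show ?thesis
    by simp
qed

text \<open>Adding a constant preserves \<open>has_derivative\<close> in both directions, hence the
  chosen map too. The equality therefore holds even on element faces, where a finite element
  function may have no derivative.\<close>

lemma frechet_derivative_add_const:
  "frechet_derivative (\<lambda>x. f x + c) (at x) = frechet_derivative f (at x)"
proof -
  have "((\<lambda>x. f x + c) has_derivative F) (at x) \<longleftrightarrow> (f has_derivative F) (at x)" for F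
    using has_derivative_add[of f F "at x" "\<lambda>_. c" "\<lambda>_. 0"]
      has_derivative_add[of "\<lambda>x. f x + c" F "at x" "\<lambda>_. - c" "\<lambda>_. 0"] by auto
  then show ?thesis
    unfolding frechet_derivative_def by simp
qed

lemma grad_add_const: "grad (\<lambda>x. f x + c) = grad f"
  by (simp add: grad_def fun_eq_iff frechet_derivative_add_const)

lemma grad_const: "grad (\<lambda>x. c) = (\<lambda>x. 0)"
  by (simp add: grad_def fun_eq_iff)

section \<open>The finite element scheme\<close>

lemma Qk_add_const:
  fixes p :: "'a::euclidean_space \<Rightarrow> real"
  assumes "p \<in> Qk k"
  shows "(\<lambda>x. p x + c) \<in> Qk k"
proof -
  obtain coef where p: "p x = (\<Sum>\<alpha>\<in>Basis \<rightarrow>\<^sub>E {..k}. coef \<alpha> * (\<Prod>i\<in>Basis. (x \<bullet> i) ^ \<alpha> i))" for x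
    using assms unfolding Qk_def by blast
  \<comment> \<open>The exponent of the constant monomial; restriction to \<open>Basis\<close> makes
    it a member of the extensional index set.\<close>
  define z :: "'a \<Rightarrow> nat" where "z = restrict (\<lambda>_. 0) Basis"
  have "p x + c = (\<Sum>\<alpha>\<in>Basis \<rightarrow>\<^sub>E {..k}. (coef \<alpha> + (if \<alpha> = z then c else 0)) *
      (\<Prod>i\<in>Basis. (x \<bullet> i) ^ \<alpha> i))" for x
  proof -
    have "finite ((Basis :: 'a set) \<rightarrow>\<^sub>E {..k})"
      by (intro finite_PiE) auto
    moreover have "z \<in> Basis \<rightarrow>\<^sub>E {..k}"
      by (auto simp: z_def)
    moreover have "(\<Prod>i\<in>Basis. (x \<bullet> i) ^ z i) = 1"
      by (simp add: z_def)
    ultimately show ?thesis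
      by (simp add: p distrib_right sum.distrib if_distrib[of "\<lambda>t. t * _"] sum.delta cong: if_cong)
  qed
  then show ?thesis
    unfolding Qk_def by (intro CollectI exI allI)
qed

lemma Qk_const: "(\<lambda>x::'a::euclidean_space. c) \<in> Qk k"
proof -
  have "(\<lambda>x::'a. 0) \<in> Qk k"
    unfolding Qk_def by (auto intro!: exI[of _ "\<lambda>_. 0"])
  from Qk_add_const[OF this, of c] show ?thesis
    by simp
qed

lemma fe_space_const: "(\<lambda>x. c) \<in> fe_space \<Omega> \<E> k"
  using Qk_const by (fastforce simp: fe_space_def)

lemma fe_space_add_const:
  assumes "v \<in> fe_space \<Omega> \<E> k"
  shows "(\<lambda>x. v x + c) \<in> fe_space \<Omega> \<E> k"
proof -
  have "\<exists>p\<in>Qk k. \<forall>x\<in>E. v x + c = p x" if "E \<in> \<E>" for E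
  proof -
    have "\<exists>p\<in>Qk k. \<forall>x\<in>E. v x = p x"
      using assms that by (simp add: fe_space_def)
    then obtain p where "p \<in> Qk k" "\<forall>x\<in>E. v x = p x"
      by (rule bexE)
    then show ?thesis
      using Qk_add_const by (intro bexI[of _ "\<lambda>x. p x + c"]) auto
  qed
  then show ?thesis
    using assms by (auto simp: fe_space_def intro!: continuous_intros)
qed

section \<open>Weak gradients and the convective term\<close>

text \<open>Expresses a partial derivative as the divergence of a field in direction
  \<open>i\<close>, the form to which integration by parts applies.\<close>

lemma divergence_scaleR_Basis:
  assumes "\<phi> differentiable (at x)" "i \<in> Basis"
  shows "divergence (\<lambda>x. \<phi> x *\<^sub>R i) x = frechet_derivative \<phi> (at x) i"
    "frechet_derivative (\<lambda>x. \<phi> x *\<^sub>R i) (at x) h = frechet_derivative \<phi> (at x) h *\<^sub>R i"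
    "(\<lambda>x. \<phi> x *\<^sub>R i) differentiable (at x)"
proof -
  have *: "((\<lambda>x. \<phi> x *\<^sub>R i) has_derivative (\<lambda>h. frechet_derivative \<phi> (at x) h *\<^sub>R i)) (at x)"
    using assms(1) by (intro has_derivative_scaleR_left) (simp add: frechet_derivative_works)
  then show "(\<lambda>x. \<phi> x *\<^sub>R i) differentiable (at x)"
    unfolding differentiable_def by blast
  show "frechet_derivative (\<lambda>x. \<phi> x *\<^sub>R i) (at x) h = frechet_derivative \<phi> (at x) h *\<^sub>R i" for h
    using frechet_derivative_at[OF *] by metis
  then show "divergence (\<lambda>x. \<phi> x *\<^sub>R i) x = frechet_derivative \<phi> (at x) i"
    using assms(2)
    by (simp add: divergence_def inner_Basis if_distrib sum.delta cong: if_cong)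
qed

text \<open>Integrate by parts with the field \<open>\<phi> x *\<^sub>R i\<close>. It vanishes on
  the boundary because the support of \<phi> lies in the open box, so its normal component vanishes
  there.\<close>

lemma weak_gradient_grad:
  fixes a b :: "'a::euclidean_space"
  assumes "box a b \<noteq> {}" "piecewise_C1 (box a b) v"
  shows "weak_gradient (box a b) v (grad v)"
  unfolding weak_gradient_def
proof (intro ballI)
  fix \<phi> :: "'a \<Rightarrow> real" and i :: 'a
  assume \<phi>: "\<phi> \<in> test_functions (box a b)" and i: "i \<in> Basis"
  let ?F = "\<lambda>x. \<phi> x *\<^sub>R i"
  have "Ck (Suc 0) \<phi>"
    using \<phi> by (auto simp: test_functions_def)
  then have d: "\<phi> differentiable (at x)"
    and c: "j \<in> Basis \<Longrightarrow> continuous_on UNIV (\<lambda>x. frechet_derivative \<phi> (at x) j)" for x j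
    by auto
  have cont: "continuous_on UNIV \<phi>"
    using d by (meson continuous_at_imp_continuous_on differentiable_imp_continuous_within)
  have zero: "\<phi> x = 0" if "x \<notin> box a b" for x
    using \<phi> that closure_subset[of "{x. \<phi> x \<noteq> 0}"] by (auto simp: test_functions_def)
  have F: "C1_open (box a b) ?F"
    unfolding C1_open_def divergence_scaleR_Basis(2)[OF d i]
    using divergence_scaleR_Basis(3)[OF d i]
    by (auto intro!: continuous_intros intro: continuous_on_subset[OF c])
  have Fc: "continuous_on (cbox a b) ?F"
    by (intro continuous_intros continuous_on_subset[OF cont]) auto
  have normal: "\<forall>x\<in>frontier (box a b). \<forall>n. outward_unit_normal a b x n \<longrightarrow> ?F x \<bullet> n = 0"
    using zero by (simp add: frontier_def interior_open[OF open_box])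
  obtain B where B: "\<forall>x\<in>cbox a b. \<bar>frechet_derivative \<phi> (at x) i\<bar> \<le> B"
  proof -
    have "bounded ((\<lambda>x. frechet_derivative \<phi> (at x) i) ` cbox a b)"
      by (intro compact_imp_bounded compact_continuous_image continuous_on_subset[OF c[OF i]]) auto
    then show ?thesis
      using that by (auto simp: bounded_iff)
  qed
  obtain B' where B': "\<forall>x\<in>box a b. \<bar>v x\<bar> \<le> B'"
    using assms(2) unfolding piecewise_C1_def by (auto simp: bounded_iff)
  have int: "integrable (lebesgue_on (box a b)) (\<lambda>x. v x * divergence ?F x)"
    unfolding divergence_scaleR_Basis(1)[OF d i]
  proof (rule integrable_lebesgue_on_bounded)
    show "(\<lambda>x. v x * frechet_derivative \<phi> (at x) i) \<in> borel_measurable (lebesgue_on (box a b))"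
      using assms(2) i unfolding piecewise_C1_def
      by (intro continuous_imp_measurable_on_sets_lebesgue continuous_on_mult)
        (auto intro: continuous_on_subset[OF c])
    have "norm (v x * frechet_derivative \<phi> (at x) i) \<le> B' * B" if "x \<in> box a b" for x
    proof -
      have "\<bar>v x\<bar> \<le> B'" "\<bar>frechet_derivative \<phi> (at x) i\<bar> \<le> B"
        using B B' that box_subset_cbox by blast+
      then show ?thesis
        unfolding real_norm_def abs_mult by (intro mult_mono) auto
    qed
    then show "AE x in lebesgue_on (box a b). norm (v x * frechet_derivative \<phi> (at x) i) \<le> B' * B"
      by (intro AE_I2) simp
  qed simp
  from integration_by_parts_box[OF assms(1) F Fc normal assms(2) int]
  show "(\<integral>x. v x * frechet_derivative \<phi> (at x) i \<partial>lebesgue_on (box a b)) =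
      - (\<integral>x. grad v x \<bullet> i * \<phi> x \<partial>lebesgue_on (box a b))"
    unfolding divergence_scaleR_Basis(1)[OF d i] by (simp add: inner_commute[of i] mult.commute)
qed

text \<open>Bounded functions on a bounded box are square integrable, and the gradient is bounded
  almost everywhere. This admits the elementwise gradient in the Poincare inequality.\<close>

lemma H1_with_gradient_grad:
  fixes a b :: "'a::euclidean_space"
  assumes "box a b \<noteq> {}" "piecewise_C1 (box a b) v"
  shows "H1_with_gradient (box a b) v (grad v)"
proof -
  obtain B where B: "\<forall>x\<in>box a b. \<bar>v x\<bar> \<le> B"
    using assms(2) unfolding piecewise_C1_def by (auto simp: bounded_iff)
  have v: "v \<in> borel_measurable (lebesgue_on (box a b))"
    using assms(2) by (intro piecewise_C1_measurable) auto
  have "integrable (lebesgue_on (box a b)) (\<lambda>x. (norm (v x))\<^sup>2)"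
  proof (rule integrable_lebesgue_on_bounded)
    have "\<bar>v x\<bar>\<^sup>2 \<le> B\<^sup>2" if "x \<in> box a b" for x
      using B that by (intro power_mono) auto
    then show "AE x in lebesgue_on (box a b). norm ((norm (v x))\<^sup>2) \<le> B\<^sup>2"
      by (intro AE_I2) simp
  qed (use v in auto)
  moreover obtain C where C: "AE x in lebesgue_on (box a b). norm (grad v x) \<le> C"
    by (rule piecewise_C1_grad_AE_bound[OF assms(2) open_box]) (rule that)
  have g: "grad v \<in> borel_measurable (lebesgue_on (box a b))"
    using assms(2) by (intro piecewise_C1_grad_measurable) auto
  have "integrable (lebesgue_on (box a b)) (\<lambda>x. (norm (grad v x))\<^sup>2)"
  proof (rule integrable_lebesgue_on_bounded)
    show "AE x in lebesgue_on (box a b). norm ((norm (grad v x))\<^sup>2) \<le> C\<^sup>2"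
      using C by eventually_elim (auto intro!: power_mono)
  qed (use g in auto)
  ultimately show ?thesis
    using v g weak_gradient_grad[OF assms] by (simp add: H1_with_gradient_def L2_def)
qed

text \<open>The integrand is half of \<open>u \<bullet> \<nabla>(v\<^sup>2)\<close>.\<close>

lemma convection_skew:
  fixes u :: "'a::euclidean_space \<Rightarrow> 'a"
  assumes ab: "box a b \<noteq> {}"
    and u: "C1_open (box a b) u" "continuous_on (cbox a b) u" "\<forall>x\<in>box a b. divergence u x = 0"
      "\<forall>x\<in>frontier (box a b). \<forall>n. outward_unit_normal a b x n \<longrightarrow> u x \<bullet> n = 0"
    and v: "piecewise_C1 (box a b) v"
  shows "(\<integral>x. v x *\<^sub>R u x \<bullet> grad v x \<partial>lebesgue_on (box a b)) = 0"
proof -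
  let ?\<psi> = "\<lambda>x. v x * v x"
  have \<psi>: "piecewise_C1 (box a b) ?\<psi>"
    using v by (intro piecewise_C1_mult)
  have z: "?\<psi> x * divergence u x = 0" if "x \<in> box a b" for x
    using u(3) that by simp
  \<comment> \<open>The divergence is known to vanish only inside the box, so zero is substituted by
    congruence on the space of the measure.\<close>
  have "integrable (lebesgue_on (box a b)) (\<lambda>x. ?\<psi> x * divergence u x) \<longleftrightarrow>
      integrable (lebesgue_on (box a b)) (\<lambda>x. 0 :: real)"
    by (rule Bochner_Integration.integrable_cong[OF refl]) (simp only: z space_lebesgue_on)
  moreover have "(\<integral>x. ?\<psi> x * divergence u x \<partial>lebesgue_on (box a b)) =
      (\<integral>x. 0 \<partial>lebesgue_on (box a b))"
    by (rule Bochner_Integration.integral_cong[OF refl]) (simp only: z space_lebesgue_on)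
  ultimately have "integrable (lebesgue_on (box a b)) (\<lambda>x. ?\<psi> x * divergence u x)"
    "(\<integral>x. ?\<psi> x * divergence u x \<partial>lebesgue_on (box a b)) = 0"
    by simp_all
  with integration_by_parts_box[OF ab u(1,2,4) \<psi>]
  have "(\<integral>x. u x \<bullet> grad ?\<psi> x \<partial>lebesgue_on (box a b)) = 0"
    by simp
  also have "(\<integral>x. u x \<bullet> grad ?\<psi> x \<partial>lebesgue_on (box a b)) =
      (\<integral>x. 2 * (v x *\<^sub>R u x \<bullet> grad v x) \<partial>lebesgue_on (box a b))"
  proof (rule integral_cong_AE)
    have "u \<in> borel_measurable (lebesgue_on (box a b))"
      using u(1) by (intro continuous_imp_measurable_on_sets_lebesgue C1_open_imp_continuous_on) auto
    then show "(\<lambda>x. u x \<bullet> grad ?\<psi> x) \<in> borel_measurable (lebesgue_on (box a b))"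
      "(\<lambda>x. 2 * (v x *\<^sub>R u x \<bullet> grad v x)) \<in> borel_measurable (lebesgue_on (box a b))"
      using piecewise_C1_grad_measurable[OF \<psi> open_box] piecewise_C1_grad_measurable[OF v open_box]
        piecewise_C1_measurable[OF v]
      by (auto intro!: borel_measurable_inner borel_measurable_times borel_measurable_scaleR)
    obtain B where "AE x in lebesgue_on (box a b). v differentiable (at x) \<and>
        (\<forall>i\<in>Basis. \<bar>frechet_derivative v (at x) i\<bar> \<le> B)"
      by (rule piecewise_C1_AE_bound[OF v open_box]) (rule that)
    then show "AE x in lebesgue_on (box a b). u x \<bullet> grad ?\<psi> x = 2 * (v x *\<^sub>R u x \<bullet> grad v x)"
      by eventually_elim
        (simp add: inner_grad frechet_derivative_mult_real sum_distrib_left algebra_simps sum.distrib)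
  qed
  finally show ?thesis
    by simp
qed

section \<open>The discrete energy estimate and its geometric iteration\<close>

theorem proposition2p4:
  fixes a b :: "'a::euclidean_space"
    and \<Omega> :: "'a set"
    and \<E> :: "'a set set"
    and k :: nat
    and D \<Delta>t \<epsilon>\<^sub>0 c \<beta> :: real
    and M :: "'a \<Rightarrow> real"
    and u :: "'a \<Rightarrow> 'a"
    and g \<rho> :: "nat \<Rightarrow> 'a \<Rightarrow> real"
  assumes dim: "DIM('a) = 1 \<or> DIM('a) = 2"
    and \<Omega>: "\<Omega> = box a b" "\<Omega> \<noteq> {}"
    and D: "D > 0"
    and \<Delta>t: "\<Delta>t > 0"
    and M: "C1_closure \<Omega> M" "\<epsilon>\<^sub>0 > 0" "\<forall>x\<in>closure \<Omega>. M x \<ge> \<epsilon>\<^sub>0"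
      "(\<integral>x. M x \<partial>lebesgue_on \<Omega>) = 1"
    and u: "C1_open \<Omega> u" "continuous_on (closure \<Omega>) u"
      "\<forall>x\<in>\<Omega>. divergence u x = 0"
      "\<forall>x\<in>frontier \<Omega>. \<forall>n. outward_unit_normal a b x n \<longrightarrow> u x \<bullet> n = 0"
    and partition: "uniform_rect_partition a b \<E>"
    and k: "k \<ge> 1"
    and c: "weighted_Poincare_constant \<Omega> M c"
    and scheme: "fe_scheme \<Omega> (fe_space \<Omega> \<E> k) D \<Delta>t M u g"
    and \<rho>: "\<forall>n x. \<rho> n x = M x * g n x"
    and mass: "(\<integral>x. \<rho> 0 x \<partial>lebesgue_on \<Omega>) = (\<integral>x. M x \<partial>lebesgue_on \<Omega>)"
    and \<beta>: "\<beta> = 2 * D * \<Delta>t / (c + 2 * D * \<Delta>t)"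
  shows "(\<forall>n. 1 / \<Delta>t * (\<integral>x. (\<rho> (Suc n) x - M x)\<^sup>2 / M x \<partial>lebesgue_on \<Omega>)
              - 1 / \<Delta>t * (\<integral>x. (\<rho> n x - M x)\<^sup>2 / M x \<partial>lebesgue_on \<Omega>)
            \<le> - (2 * D / c) * (\<integral>x. (\<rho> (Suc n) x - M x)\<^sup>2 / M x \<partial>lebesgue_on \<Omega>)) \<and>
         (\<forall>n. (\<integral>x. (\<rho> n x - M x)\<^sup>2 / M x \<partial>lebesgue_on \<Omega>)
                \<le> (1 - \<beta>) ^ n * (\<integral>x. (\<rho> 0 x - M x)\<^sup>2 / M x \<partial>lebesgue_on \<Omega>) \<and>
              (1 - \<beta>) ^ n * (\<integral>x. (\<rho> 0 x - M x)\<^sup>2 / M x \<partial>lebesgue_on \<Omega>)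
                \<le> exp (- \<beta> * real n) * (\<integral>x. (\<rho> 0 x - M x)\<^sup>2 / M x \<partial>lebesgue_on \<Omega>)) \<and>
         \<beta> > 0"
proof -
  let ?L = "lebesgue_on \<Omega>"
  \<comment> \<open>Subtraction of 1 is written as an addition to fit the lemmas on adding a
    constant.\<close>
  define w where "w n x = g n x + (- 1)" for n x
  \<comment> \<open>Since \<open>\<rho> = M * g\<close>, the integrand
    \<open>(\<rho> - M)\<^sup>2 / M\<close> of the theorem equals
    \<open>M * w\<^sup>2\<close>.\<close>
  define E where "E n = (\<integral>x. M x * (w n x * w n x) \<partial>?L)" for n
  have cl: "closure \<Omega> = cbox a b"
    using \<Omega> by (auto simp: closure_box)
  have g_fe: "g n \<in> fe_space \<Omega> \<E> k" for n
    using scheme by (simp add: fe_scheme_def)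
  then have w_fe: "w n \<in> fe_space \<Omega> \<E> k" for n
    unfolding w_def by (rule fe_space_add_const)
  have pw: "piecewise_C1 \<Omega> (w n)" for n
    using fe_space_imp_piecewise_C1[OF partition w_fe[of n, unfolded \<Omega>(1)]] \<Omega>(1) by simp
  have pg: "piecewise_C1 \<Omega> (g n)" for n
    using fe_space_imp_piecewise_C1[OF partition g_fe[of n, unfolded \<Omega>(1)]] \<Omega>(1) by simp
  have grad_w: "grad (w n) = grad (g n)" for n
    unfolding w_def by (rule grad_add_const)
  have M_pos: "M x > 0" if "x \<in> \<Omega>" for x
    using M(2,3) closure_subset that by force
  have contM: "continuous_on (cbox a b) M"
    using M(1) by (simp add: C1_closure_def cl)
  then have "bounded (M ` cbox a b)"
    by (intro compact_imp_bounded compact_continuous_image) auto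
  then obtain C where C: "\<forall>x\<in>cbox a b. \<bar>M x\<bar> \<le> C"
    by (auto simp: bounded_iff)
  have intM: "integrable ?L (\<lambda>x. M x * h x)" if h: "piecewise_C1 \<Omega> h" for h
  proof -
    obtain B where B: "\<forall>x\<in>\<Omega>. \<bar>h x\<bar> \<le> B"
      using h unfolding piecewise_C1_def by (auto simp: bounded_iff)
    have "norm (M x * h x) \<le> C * B" if "x \<in> \<Omega>" for x
    proof -
      have "\<bar>M x\<bar> \<le> C" "\<bar>h x\<bar> \<le> B"
        using B C that \<Omega>(1) box_subset_cbox by blast+
      then show ?thesis
        unfolding real_norm_def abs_mult by (intro mult_mono) auto
    qed
    then have "AE x in ?L. norm (M x * h x) \<le> C * B"
      by (intro AE_I2) simp
    moreover have "(\<lambda>x. M x * h x) \<in> borel_measurable ?L"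
      using h continuous_on_subset[OF contM box_subset_cbox] \<Omega>(1) unfolding piecewise_C1_def
      by (intro continuous_imp_measurable_on_sets_lebesgue continuous_on_mult)
        auto
    ultimately show ?thesis
      using \<Omega>(1) by (intro integrable_lebesgue_on_bounded) simp_all
  qed
  have int1: "integrable ?L M"
    using intM[OF piecewise_C1_const, of 1] by simp
  have E_eq: "(\<integral>x. (\<rho> n x - M x)\<^sup>2 / M x \<partial>?L) = E n" for n
    unfolding E_def
  proof (rule Bochner_Integration.integral_cong[OF refl])
    fix x assume "x \<in> space ?L"
    then have "M x > 0"
      using M_pos by simp
    then show "(\<rho> n x - M x)\<^sup>2 / M x = M x * (w n x * w n x)"
      using \<rho> by (simp add: w_def power2_eq_square field_simps)
  qed
  have step: "L2_inner \<Omega> (\<lambda>x. M x * g (Suc n) x) \<phi>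
        + \<Delta>t * L2_inner \<Omega> (\<lambda>x. (D * M x) *\<^sub>R grad (g (Suc n)) x) (grad \<phi>)
        + \<Delta>t * L2_inner \<Omega> (\<lambda>x. g (Suc n) x *\<^sub>R u x) (grad \<phi>)
        = L2_inner \<Omega> (\<lambda>x. M x * g n x) \<phi>" if "\<phi> \<in> fe_space \<Omega> \<E> k" for n \<phi>
    using scheme that by (simp add: fe_scheme_def)
  \<comment> \<open>The test function 1 has zero gradient, so only the two mass terms of the scheme
    survive.\<close>
  have mass_n: "(\<integral>x. M x * g n x \<partial>?L) = (\<integral>x. M x \<partial>?L)" for n
  proof (induction n)
    case 0
    then show ?case
      using mass \<rho> by simp
  next
    case (Suc n)
    then show ?case
      using step[OF fe_space_const, of n 1] by (simp add: L2_inner_def grad_const)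
  qed
  have mean_zero: "(\<integral>x. w n x * M x \<partial>?L) = 0" for n
  proof -
    have "(\<integral>x. w n x * M x \<partial>?L) = (\<integral>x. M x * g n x - M x \<partial>?L)"
      by (simp add: w_def algebra_simps)
    also have "\<dots> = 0"
      using intM[OF pg] int1 by (simp add: mass_n)
    finally show ?thesis .
  qed
  define G where "G n = (\<integral>x. M x * (norm (grad (w n) x))\<^sup>2 \<partial>?L)" for n
  have poincare: "E n \<le> c * G n" for n
  proof -
    have "(\<integral>x. \<bar>w n x\<bar>\<^sup>2 * M x \<partial>?L) \<le> c * G n"
      using c H1_with_gradient_grad[of a b "w n"] \<Omega> pw[of n] mean_zero[of n]
      unfolding weighted_Poincare_constant_def G_def by blast
    then show ?thesis
      by (simp add: E_def power2_eq_square mult_ac)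
  qed
  have conv: "L2_inner \<Omega> (\<lambda>x. g n x *\<^sub>R u x) (grad (g n)) = 0" for n
    unfolding L2_inner_def \<Omega>(1)
    using \<Omega> u pg[of n] cl by (intro convection_skew) auto
  have "c > 0"
    using c by (simp add: weighted_Poincare_constant_def)
  have energy: "E (Suc n) - E n \<le> - (2 * \<Delta>t * D) * G (Suc n)" for n
  proof -
    let ?w = "w (Suc n)"
    \<comment> \<open>Replacing \<open>g m\<close> by \<open>w m\<close> changes the integral by the
      weighted mean of \<open>w (Suc n)\<close>, which is zero.\<close>
    have *: "(\<integral>x. M x * g m x * ?w x \<partial>?L) = (\<integral>x. M x * (w m x * ?w x) \<partial>?L)" for m
    proof -
      have "(\<integral>x. M x * g m x * ?w x \<partial>?L) = (\<integral>x. M x * (w m x * ?w x) + ?w x * M x \<partial>?L)"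
        by (simp add: w_def algebra_simps)
      also have "\<dots> = (\<integral>x. M x * (w m x * ?w x) \<partial>?L)"
        using intM[OF piecewise_C1_mult[OF pw pw]] intM[OF pw]
        by (simp add: mult.commute[of "?w _"] mean_zero[unfolded mult.commute[of "w _ _"]])
      finally show ?thesis .
    qed
    have diff: "L2_inner \<Omega> (\<lambda>x. (D * M x) *\<^sub>R grad (g (Suc n)) x) (grad ?w) = D * G (Suc n)"
      by (simp add: L2_inner_def G_def grad_w power2_norm_eq_inner mult.assoc)
    \<comment> \<open>The scheme is tested with \<open>w (Suc n)\<close>. Its gradient is that of
      \<open>g (Suc n)\<close>, so the convective term vanishes by \<open>conv\<close>.\<close>
    have "E (Suc n) + \<Delta>t * (D * G (Suc n)) = (\<integral>x. M x * (w n x * ?w x) \<partial>?L)"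
      using step[OF w_fe, of n "Suc n"] unfolding diff unfolding grad_w conv
      by (simp add: L2_inner_def * E_def)
    \<comment> \<open>Young's inequality weighted by \<open>M\<close>. Half of the new energy is
      absorbed on the left, which produces the factor 2 in front of the dissipation.\<close>
    also have "\<dots> \<le> (\<integral>x. 1/2 * (M x * (w n x * w n x)) + 1/2 * (M x * (?w x * ?w x)) \<partial>?L)"
    proof (rule integral_mono)
      fix x assume "x \<in> space ?L"
      then have "M x > 0"
        using M_pos by simp
      have "2 * (w n x * ?w x) \<le> w n x * w n x + ?w x * ?w x"
        using sum_squares_bound[of "w n x" "?w x"] by (simp add: power2_eq_square)
      from mult_left_mono[OF this, of "M x"] \<open>M x > 0\<close>
      show "M x * (w n x * ?w x) \<le> 1/2 * (M x * (w n x * w n x)) + 1/2 * (M x * (?w x * ?w x))"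
        by (simp add: algebra_simps)
    qed (use intM[OF piecewise_C1_mult[OF pw pw]] in auto)
    also have "\<dots> = 1/2 * E n + 1/2 * E (Suc n)"
      using intM[OF piecewise_C1_mult[OF pw pw]] by (simp add: E_def)
    finally show ?thesis
      by (simp add: algebra_simps)
  qed
  \<comment> \<open>The Poincare inequality bounds the dissipation \<open>G (Suc n)\<close> below by
    \<open>E (Suc n) / c\<close>.\<close>
  have decay: "E (Suc n) - E n \<le> - (2 * D * \<Delta>t / c) * E (Suc n)" for n
  proof -
    have "(2 * D * \<Delta>t / c) * E (Suc n) \<le> (2 * D * \<Delta>t / c) * (c * G (Suc n))"
      using poincare D \<Delta>t \<open>c > 0\<close> by (intro mult_left_mono) auto
    then show ?thesis
      using energy[of n] \<open>c > 0\<close> by (simp add: mult_ac)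
  qed
  have part1: "1 / \<Delta>t * E (Suc n) - 1 / \<Delta>t * E n \<le> - (2 * D / c) * E (Suc n)" for n
  proof -
    have "1 / \<Delta>t * (E (Suc n) - E n) \<le> 1 / \<Delta>t * (- (2 * D * \<Delta>t / c) * E (Suc n))"
      using decay \<Delta>t by (intro mult_left_mono) auto
    then show ?thesis
      using \<Delta>t by (simp add: algebra_simps)
  qed
  have DT: "0 < 2 * D * \<Delta>t"
    using D \<Delta>t by simp
  have "\<beta> > 0"
    using DT \<open>c > 0\<close> by (simp add: \<beta>)
  have one_minus: "1 - \<beta> = c / (c + 2 * D * \<Delta>t)"
    using DT \<open>c > 0\<close> by (simp add: \<beta> field_simps)
  then have "1 - \<beta> \<ge> 0"
    using DT \<open>c > 0\<close> by simp
  \<comment> \<open>Multiplying the decay estimate by \<open>c\<close> and collecting the new energy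
    on the left gives the factor \<open>c / (c + 2 * D * \<Delta>t)\<close>, which is
    \<open>1 - \<beta>\<close>.\<close>
  have contract: "E (Suc n) \<le> (1 - \<beta>) * E n" for n
  proof -
    have "(c + 2 * D * \<Delta>t) * E (Suc n) \<le> c * E n"
      using mult_left_mono[OF decay[of n], of c] \<open>c > 0\<close> by (simp add: algebra_simps)
    then show ?thesis
      unfolding one_minus using DT \<open>c > 0\<close> by (simp add: field_simps)
  qed
  have geometric: "E n \<le> (1 - \<beta>) ^ n * E 0" for n
  proof (induction n)
    case (Suc n)
    have "E (Suc n) \<le> (1 - \<beta>) * E n"
      by (rule contract)
    also have "\<dots> \<le> (1 - \<beta>) * ((1 - \<beta>) ^ n * E 0)"
      using Suc \<open>1 - \<beta> \<ge> 0\<close> by (rule mult_left_mono)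
    finally show ?case
      by (simp add: mult.assoc)
  qed simp
  have "E 0 \<ge> 0"
    unfolding E_def using M_pos by (intro integral_nonneg_AE AE_I2) (simp add: less_imp_le)
  have exponential: "(1 - \<beta>) ^ n * E 0 \<le> exp (- \<beta> * real n) * E 0" for n
  proof (rule mult_right_mono[OF _ \<open>E 0 \<ge> 0\<close>])
    \<comment> \<open>The inequality \<open>1 - \<beta> \<le> exp (- \<beta>)\<close> is raised to
      the power \<open>n\<close>, which preserves it because the smaller base is
      nonnegative.\<close>
    have "(1 - \<beta>) ^ n \<le> exp (- \<beta>) ^ n"
      using exp_ge_add_one_self[of "- \<beta>"] \<open>1 - \<beta> \<ge> 0\<close> by (intro power_mono) auto
    also have "\<dots> = exp (- \<beta> * real n)"
      by (simp add: exp_of_nat_mult[symmetric] mult.commute)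
    finally show "(1 - \<beta>) ^ n \<le> exp (- \<beta> * real n)" .
  qed
  show ?thesis
    unfolding E_eq using part1 geometric exponential \<open>\<beta> > 0\<close> by blast
qed

end
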